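(* Let $S$ be a countable set, $(E,\mathcal E)$ a standard Borel space, $(\Omega,\mathcal F)=(E^S,\mathcal E^{S})$, and let $(H,\mathcal H,\mathbb P)$ be a probability space. Let $\gamma[\cdot]=(\gamma[\xi])_{\xi\in H}$ be a random specification on $\Omega$ such that $\mathcal G(\gamma[\xi])\neq\emptyset$ for $\mathbb P$-almost all $\xi$, and let $\xi\mapsto\mu[\xi]$ be a random infinite-volume Gibbs measure, i.e. an $\mathcal H$–$e(\mathcal P(\Omega))$ measurable map $H\to\mathcal P(\Omega)$ with $\mu[\xi]\in\mathcal G(\gamma[\xi])$ for $\mathbb P$-almost all $\xi$. Then there is a kernel $\pi$, $(\xi,\omega,A)\mapsto\pi[\xi](A|\omega)$, such that $\pi[\xi](\cdot|\omega)\in\mathcal P(\Omega)$ for all $(\xi,\omega)\in H\times\Omega$ and $(\xi,\omega)\mapsto\pi[\xi](A|\omega)$ is $\mathcal H\otimes\mathcal F$ measurable for every $A\in\mathcal F$, and such that, defining $$w[\xi]_{\mu}(M)=\mu\big(\{\omega\in\Omega:\ \pi[\xi](\cdot|\omega)\in M\}\big)\qquad\text{for } M\in e(\mathcal P(\Omega)),\ \mu\in\mathcal P(\Omega),\ \xi\in H,$$ the map $H\to\mathcal P(\mathcal P(\Omega))$, $\xi\mapsto w[\xi]_{\mu[\xi]}$, is $\mathcal H$–$e(\mathcal P(\mathcal P(\Omega)))$ measurable and the following hold. 1. For $\mathbb P$-almost every $\xi\in H$, the measure $w[\xi]_{\mu[\xi]}$ is supported on the extremal Gibbs measures, i.e.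 $w[\xi]_{\mu[\xi]}(\mathrm{ex}\,\mathcal G(\gamma[\xi]))=1$, so that $w[\xi]_{\mu[\xi]}\in\mathcal P\big(\mathrm{ex}\,\mathcal G(\gamma[\xi]),e(\mathrm{ex}\,\mathcal G(\gamma[\xi]))\big)$. 2. For $\mathbb P$-almost every $\xi\in H$, $$\mu[\xi]=\int_{\mathrm{ex}\,\mathcal G(\gamma[\xi])}w[\xi]_{\mu[\xi]}(d\nu)\,\nu .$$
   Context: For a measurable space $X$, $\mathcal P(X)$ is the set of probability measures on $X$, and the evaluation sigma-algebra $e(\mathcal P(X))$ is the smallest sigma-algebra on $\mathcal P(X)$ making all maps $\nu\mapsto\nu(A)$, $A\subset X$ measurable, measurable. $\mathcal P(\Omega)$ always carries $e(\mathcal P(\Omega))$; $\mathcal P(\mathcal P(\Omega))=\mathcal P(\mathcal P(\Omega),e(\mathcal P(\Omega)))$ carries its own evaluation sigma-algebra $e(\mathcal P(\mathcal P(\Omega)))$. For a subset $G\subset\mathcal P(\Omega)$, $e(G)$ is the evaluation sigma-algebra on $G$, i.e. the trace of $e(\mathcal P(\Omega))$ on $G$. $\Lambda\Subset S$ means $\Lambda$ is a finite subset of $S$; $\Lambda^c=S\setminus\Lambda$; for $\Delta\subset S$, $\mathcal F_\Delta\subset\mathcal F$ is the sigma-algebra generated by the coordinates in $\Delta$. A specification $\gamma=(\gamma_\Lambda)_{\Lambda\Subset S}$ is a family of probability kernels $\gamma_\Lambda(\cdot|\cdot)$ from $(\Omega,\mathcal F_{\Lambda^c})$ to $(\Omega,\mathcal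 F)$ (so $\gamma_\Lambda(\cdot|\omega)\in\mathcal P(\Omega)$, and $\gamma_\Lambda(A|\cdot)$ is $\mathcal F_{\Lambda^c}$-measurable for $A\in\mathcal F$) that is consistent: $\int\gamma_\Lambda(d\sigma|\omega)\gamma_\Delta(A|\sigma)=\gamma_\Lambda(A|\omega)$ for all finite $\Delta\subset\Lambda$, $A\in\mathcal F$, $\omega\in\Omega$; and proper: $\gamma_\Lambda(A|\omega)=\mathbf 1_A(\omega)$ for all $A\in\mathcal F_{\Lambda^c}$. No quasilocality or non-nullness is assumed. A random specification is a family $(\gamma[\xi])_{\xi\in H}$ of specifications such that for all $\Lambda\Subset S$ and $A\in\mathcal F$ the map $(\xi,\omega)\mapsto\gamma_\Lambda[\xi](A|\omega)$ is $(\mathcal H\otimes\mathcal F)$–$\mathcal B[0,1]$ measurable. For a specification $\gamma$, $\mathcal G(\gamma)$ is the set of infinite-volume Gibbs measures: all $\mu\in\mathcal P(\Omega)$ with $\int\mu(d\omega)\gamma_\Lambda(A|\omega)=\mu(A)$ for all $\Lambda\Subset S$, $A\in\mathcal F$. It is convex, and $\mathrm{ex}\,\mathcal G(\gamma)$ denotes its set of extreme points. An identity $\mu=\int w(d\nu)\,\nu$ means $\mu(A)=\int w(d\nu)\,\nu(A)$ for all $A\in\mathcal F$. *)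

theory Defs
  imports "HOL-Probability.Probability"
begin

definition standard_borel :: "'a measure \<Rightarrow> bool" where
  "standard_borel M \<longleftrightarrow>
     (\<exists>X. completely_metrizable_space X \<and> separable_space X \<and>
          topspace X = space M \<and> sets M = sigma_sets (topspace X) {U. openin X U})"

abbreviation config_space :: "'i set \<Rightarrow> 'e measure \<Rightarrow> ('i \<Rightarrow> 'e) measure" where
  "config_space S E \<equiv> PiM S (\<lambda>_. E)"

definition coord_algebra :: "'i set \<Rightarrow> 'e measure \<Rightarrow> 'i set \<Rightarrow> ('i \<Rightarrow> 'e) measure" where
  "coord_algebra S E \<Delta> =
     sigma (space (config_space S E))
       {(\<lambda>\<omega>. \<omega> i) -` A \<inter> space (config_space S E) |i A. i \<in> \<Delta> \<and> A \<in> sets E}"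

text \<open>
  Throughout, the set of probability measures on a measurable space \<open>M\<close>, with the evaluation
  sigma-algebra, is \<^term>\<open>prob_algebra M\<close>: its points are the measures \<open>N\<close> with
  \<^prop>\<open>sets N = sets M\<close> and \<^prop>\<open>prob_space N\<close>.
\<close>

definition prob_kernel :: "'a measure \<Rightarrow> 'b measure \<Rightarrow> ('a \<Rightarrow> 'b measure) \<Rightarrow> bool" where
  "prob_kernel M N \<kappa> \<longleftrightarrow>
     (\<forall>x\<in>space M. \<kappa> x \<in> space (prob_algebra N)) \<and>
     (\<forall>A\<in>sets N. (\<lambda>x. emeasure (\<kappa> x) A) \<in> borel_measurable M)"

lemma prob_kernel_iff_measurable: "prob_kernel M N \<kappa> \<longleftrightarrow> \<kappa> \<in> M \<rightarrow>\<^sub>M prob_algebra N"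
proof
  assume "prob_kernel M N \<kappa>"
  then show "\<kappa> \<in> M \<rightarrow>\<^sub>M prob_algebra N"
    by (intro measurable_prob_algebraI measurable_subprob_algebra)
       (auto simp: prob_kernel_def space_prob_algebra intro: prob_space_imp_subprob_space)
next
  assume k: "\<kappa> \<in> M \<rightarrow>\<^sub>M prob_algebra N"
  show "prob_kernel M N \<kappa>"
    unfolding prob_kernel_def
    using measurable_space[OF k]
      measurable_compose[OF measurable_prob_algebraD[OF k] measurable_emeasure_subprob_algebra]
    by blast
qed

text \<open>
  A specification is only constrained at \<open>\<gamma> \<Lambda> \<omega>\<close> for finite \<open>\<Lambda> \<subseteq> S\<close> and configurations
  \<open>\<omega>\<close> in the space; other values are irrelevant.
\<close>

definition is_specification ::
    "'i set \<Rightarrow> 'e measure \<Rightarrow> ('i set \<Rightarrow> ('i \<Rightarrow> 'e) \<Rightarrow> ('i \<Rightarrow> 'e) measure) \<Rightarrow> bool" where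
  "is_specification S E \<gamma> \<longleftrightarrow>
     (\<forall>\<Lambda>. finite \<Lambda> \<and> \<Lambda> \<subseteq> S \<longrightarrow>
        prob_kernel (coord_algebra S E (S - \<Lambda>)) (config_space S E) (\<gamma> \<Lambda>)) \<and>
     (\<forall>\<Lambda> \<Delta>. finite \<Lambda> \<and> \<Lambda> \<subseteq> S \<and> \<Delta> \<subseteq> \<Lambda> \<longrightarrow>
        (\<forall>A\<in>sets (config_space S E). \<forall>\<omega>\<in>space (config_space S E).
           (\<integral>\<^sup>+\<sigma>. emeasure (\<gamma> \<Delta> \<sigma>) A \<partial>\<gamma> \<Lambda> \<omega>) = emeasure (\<gamma> \<Lambda> \<omega>) A)) \<and>
     (\<forall>\<Lambda>. finite \<Lambda> \<and> \<Lambda> \<subseteq> S \<longrightarrow>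
        (\<forall>A\<in>sets (coord_algebra S E (S - \<Lambda>)). \<forall>\<omega>\<in>space (config_space S E).
           emeasure (\<gamma> \<Lambda> \<omega>) A = indicator A \<omega>))"

definition random_specification ::
    "'i set \<Rightarrow> 'e measure \<Rightarrow> 'h measure \<Rightarrow>
      ('h \<Rightarrow> 'i set \<Rightarrow> ('i \<Rightarrow> 'e) \<Rightarrow> ('i \<Rightarrow> 'e) measure) \<Rightarrow> bool" where
  "random_specification S E H \<gamma> \<longleftrightarrow>
     (\<forall>\<xi>\<in>space H. is_specification S E (\<gamma> \<xi>)) \<and>
     (\<forall>\<Lambda>. finite \<Lambda> \<and> \<Lambda> \<subseteq> S \<longrightarrow>
        (\<forall>A\<in>sets (config_space S E).
           (\<lambda>(\<xi>, \<omega>). emeasure (\<gamma> \<xi> \<Lambda> \<omega>) A)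
             \<in> borel_measurable (H \<Otimes>\<^sub>M config_space S E)))"

definition gibbs_measures ::
    "'i set \<Rightarrow> 'e measure \<Rightarrow> ('i set \<Rightarrow> ('i \<Rightarrow> 'e) \<Rightarrow> ('i \<Rightarrow> 'e) measure) \<Rightarrow>
      ('i \<Rightarrow> 'e) measure set" where
  "gibbs_measures S E \<gamma> =
     {\<mu> \<in> space (prob_algebra (config_space S E)).
        \<forall>\<Lambda>. finite \<Lambda> \<and> \<Lambda> \<subseteq> S \<longrightarrow>
          (\<forall>A\<in>sets (config_space S E). (\<integral>\<^sup>+\<omega>. emeasure (\<gamma> \<Lambda> \<omega>) A \<partial>\<mu>) = emeasure \<mu> A)}"

text \<open>
  The type of measures is not a vector space, so \<^const>\<open>extreme_point_of\<close> does not apply; this is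
  the same definition with the convex combination taken setwise.
\<close>

definition extreme_measures :: "'a measure set \<Rightarrow> 'a measure set" where
  "extreme_measures G =
     {\<mu> \<in> G. \<forall>\<nu>\<^sub>1\<in>G. \<forall>\<nu>\<^sub>2\<in>G. \<forall>t::real. 0 < t \<and> t < 1 \<and>
        (\<forall>A\<in>sets \<mu>. measure \<mu> A = t * measure \<nu>\<^sub>1 A + (1 - t) * measure \<nu>\<^sub>2 A)
        \<longrightarrow> \<nu>\<^sub>1 = \<nu>\<^sub>2}"

text \<open>
  \<open>kernel_weight \<Omega> \<kappa> \<mu>\<close> is the measure \<open>w\<^sub>\<mu>(M) = \<mu> {\<omega>. \<kappa>(\<cdot>|\<omega>) \<in> M}\<close> on the evaluation sigma-algebra.
\<close>

definition kernel_weight ::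
    "'a measure \<Rightarrow> ('a \<Rightarrow> 'a measure) \<Rightarrow> 'a measure \<Rightarrow> 'a measure measure" where
  "kernel_weight \<Omega> \<kappa> \<mu> = distr \<mu> (prob_algebra \<Omega>) \<kappa>"

lemma emeasure_kernel_weight:
  assumes "prob_kernel \<Omega> \<Omega> \<kappa>" "\<mu> \<in> space (prob_algebra \<Omega>)" "M \<in> sets (prob_algebra \<Omega>)"
  shows "emeasure (kernel_weight \<Omega> \<kappa> \<mu>) M = emeasure \<mu> {\<omega> \<in> space \<Omega>. \<kappa> \<omega> \<in> M}"
proof -
  have s: "sets \<mu> = sets \<Omega>" using assms(2) by (simp add: space_prob_algebra)
  have "\<kappa> \<in> \<mu> \<rightarrow>\<^sub>M prob_algebra \<Omega>"
    using assms(1) by (simp add: prob_kernel_iff_measurable measurable_cong_sets[OF s refl])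
  moreover have "\<kappa> -` M \<inter> space \<mu> = {\<omega> \<in> space \<Omega>. \<kappa> \<omega> \<in> M}"
    using sets_eq_imp_space_eq[OF s] by auto
  ultimately show ?thesis using assms(3) by (simp add: kernel_weight_def emeasure_distr)
qed

end

theory Submission
  imports Defs
begin

text \<open>
  The configuration space is a measurable retract of the unit interval. Exhaust \<open>S\<close> by finite
  windows \<open>\<Lambda>\<^sub>n\<close> and let \<open>\<pi>[\<xi>](\<cdot>|\<omega>)\<close> be the limit of \<open>\<gamma>\<^bsub>\<Lambda>\<^sub>n\<^esub>[\<xi>](\<cdot>|\<omega>)\<close>, taken through the
  distribution functions on the interval, so that joint measurability is clear. For a Gibbs measure
  \<open>\<mu>\<close> the sequence \<open>\<gamma>\<^bsub>\<Lambda>\<^sub>n\<^esub>(A|\<cdot>)\<close> consists of the conditional probabilities of \<open>A\<close> given the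
  configuration outside \<open>\<Lambda>\<^sub>n\<close>; it is a reverse martingale, hence converges almost surely, and \<open>\<pi>\<close>
  is a regular version of \<open>\<mu>\<close> conditioned on the tail sigma-algebra. Tail measurable functions are
  therefore almost surely constant under \<open>\<pi>(\<cdot>|\<omega>)\<close>, which is the extremality of \<open>\<pi>(\<cdot>|\<omega>)\<close>, and
  integrating \<open>\<pi>\<close> against \<open>\<mu>\<close> gives \<open>\<mu>\<close> back.
\<close>

subsection \<open>Measurable retracts of the unit interval\<close>

text \<open>Two quantifier problems shape the construction. Martingale convergence holds off a null
  set that depends on the event and on the Gibbs measure, whereas the kernel must be chosen before
  either is known and for all \<xi> at once. Hence the limit is a formula in the specification
  alone, built from lower limits of distribution functions, and only its almost sure properties
  refer to a Gibbs measure. Secondly, the tail sigma-algebra is in general not countably generated: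
  that each single tail function is constant under \<pi>(.|\<omega>) for almost every \<omega> does
  not give one null set good for all of them. The way out is that one kernel \<pi> represents the
  tail conditional probabilities of every Gibbs measure. It is then enough to test the functions
  \<pi>(A|.) for countably many \<open>A\<close>, the sublevel sets of the coding function at
  rational levels; a Gibbs measure under which these are constant is already extreme.\<close>

text \<open>
  Working with a measurable left inverse instead of a Borel isomorphism onto the image means that
  a measure on the target can always be pulled back, whether or not it is carried by the image.
\<close>

definition measurable_retract :: "'a measure \<Rightarrow> 'b measure \<Rightarrow> bool" where
  "measurable_retract M N \<longleftrightarrow>
     (\<exists>\<phi>\<in>M \<rightarrow>\<^sub>M N. \<exists>\<rho>\<in>N \<rightarrow>\<^sub>M M. \<forall>x\<in>space M. \<rho> (\<phi> x) = x)"

lemma measurable_retract_trans: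
  assumes "measurable_retract L M" "measurable_retract M N"
  shows "measurable_retract L N"
proof -
  obtain f r where f: "f \<in> L \<rightarrow>\<^sub>M M" "r \<in> M \<rightarrow>\<^sub>M L" "\<forall>x\<in>space L. r (f x) = x"
    using assms(1) unfolding measurable_retract_def by blast
  obtain g s where g: "g \<in> M \<rightarrow>\<^sub>M N" "s \<in> N \<rightarrow>\<^sub>M M" "\<forall>x\<in>space M. s (g x) = x"
    using assms(2) unfolding measurable_retract_def by blast
  have "g \<circ> f \<in> L \<rightarrow>\<^sub>M N" "r \<circ> s \<in> N \<rightarrow>\<^sub>M L"
    using f g by (auto intro: measurable_comp)
  moreover have "\<forall>x\<in>space L. (r \<circ> s) ((g \<circ> f) x) = x"
    using f g measurable_space[OF f(1)] by auto
  ultimately show ?thesis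
    unfolding measurable_retract_def by blast
qed

lemma measurable_retract_PiM:
  assumes "measurable_retract M N"
  shows "measurable_retract (PiM S (\<lambda>_. M)) (PiM S (\<lambda>_. N))"
proof -
  obtain f r where f[measurable]: "f \<in> M \<rightarrow>\<^sub>M N" "r \<in> N \<rightarrow>\<^sub>M M"
    and fr: "\<And>x. x \<in> space M \<Longrightarrow> r (f x) = x"
    using assms unfolding measurable_retract_def by blast
  have "(\<lambda>\<omega>. \<lambda>i\<in>S. f (\<omega> i)) \<in> PiM S (\<lambda>_. M) \<rightarrow>\<^sub>M PiM S (\<lambda>_. N)"
    "(\<lambda>\<omega>. \<lambda>i\<in>S. r (\<omega> i)) \<in> PiM S (\<lambda>_. N) \<rightarrow>\<^sub>M PiM S (\<lambda>_. M)"
    by measurable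
  moreover have "(\<lambda>i\<in>S. r ((\<lambda>i\<in>S. f (\<omega> i)) i)) = \<omega>" if "\<omega> \<in> space (PiM S (\<lambda>_. M))" for \<omega>
    using that fr by (fastforce simp: space_PiM PiE_iff extensional_def fun_eq_iff)
  ultimately show ?thesis
    unfolding measurable_retract_def by (meson bexI)
qed

text \<open>A point is determined by its distances to a dense sequence, and these countably many
  real coordinates generate the Borel sets. The target is a power of the reals because
  \<open>PiM_borel_measurable_retract\<close> then handles a single factor and the whole
  configuration space by the same coding.\<close>

lemma standard_borel_measurable_retract:
  fixes E :: "'a measure"
  assumes "standard_borel E" "space E \<noteq> {}"
  shows "measurable_retract E (PiM (UNIV :: nat set) (\<lambda>_. borel :: real measure))"
proof -
  obtain M d where "Metric_space M d" and compl: "Metric_space.mcomplete M d"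
    and sep: "separable_space (Metric_space.mtopology M d)"
    and M: "M = space E"
    and sets_E: "sets E = sigma_sets M {U. openin (Metric_space.mtopology M d) U}"
    using assms(1) unfolding standard_borel_def completely_metrizable_space_def
    by (metis Metric_space.topspace_mtopology)
  interpret Metric_space M d by fact
  obtain C where C: "countable C" "C \<subseteq> M" "mtopology closure_of C = M"
    using sep by (auto simp: separable_space_def)
  have "C \<noteq> {}"
    using C(3) assms(2) M by auto
  define c where "c = from_nat_into C"
  have cM: "c k \<in> M" for k
    using C(2) \<open>C \<noteq> {}\<close> from_nat_into[of C] by (auto simp: c_def)
  have dense: "\<exists>k. d x (c k) < e" if xe: "x \<in> M" "e > 0" for x e
  proof -
    have "x \<in> mtopology closure_of C"
      using C(3) xe by simp
    then obtain y where "y \<in> C" "y \<in> mball x e"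
      using xe unfolding metric_closure_of by blast
    then show ?thesis
      using C(1) by (auto simp: c_def dest!: from_nat_into_surj[OF C(1)])
  qed
  let ?R = "PiM (UNIV :: nat set) (\<lambda>_. borel :: real measure)"
  \<comment> \<open>\<open>f\<close> is the Kuratowski embedding along the dense sequence \<open>c\<close>; completeness makes its image the
    explicit Borel set \<open>Y\<close>.\<close>
  define f where "f x = (\<lambda>k. d x (c k))" for x
  define Y where "Y = {y \<in> space ?R. (\<forall>m. \<exists>k. y k < 1 / Suc m) \<and>
    (\<forall>k l. \<bar>y k - y l\<bar> \<le> d (c k) (c l) \<and> d (c k) (c l) \<le> y k + y l)}"
  have Y_sets: "Y \<in> sets ?R"
    unfolding Y_def by measurable
  have ball: "{x \<in> M. d x (c k) < r} = mball (c k) r" for k r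
    by (auto simp: cM commute)
  have f_meas: "f \<in> E \<rightarrow>\<^sub>M ?R"
    unfolding f_def
  proof (rule measurable_PiM_single')
    fix k :: nat
    show "(\<lambda>x. d x (c k)) \<in> borel_measurable E"
    proof (rule borel_measurableI_less)
      fix r
      have "mball (c k) r \<in> sets E"
        unfolding sets_E by (rule sigma_sets.Basic) simp
      then show "{x \<in> space E. d x (c k) < r} \<in> sets E"
        using ball[of k r] M by simp
    qed
  qed auto
  have f_Y: "f x \<in> Y" if "x \<in> M" for x
  proof -
    have "\<bar>d x (c k) - d x (c l)\<bar> \<le> d (c k) (c l)" for k l
      using triangle[of x "c l" "c k"] triangle[of x "c k" "c l"] that cM commute
      by (smt (verit, best))
    moreover have "d (c k) (c l) \<le> d x (c k) + d x (c l)" for k l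
      using triangle[of "c k" x "c l"] that cM commute by (smt (verit, best))
    ultimately show ?thesis
      using dense[OF that] by (auto simp: f_def Y_def space_PiM)
  qed
  have f_inj: "x = y" if xy: "x \<in> M" "y \<in> M" "f x = f y" for x y
  proof (rule ccontr)
    assume "x \<noteq> y"
    then have "d x y > 0"
      using xy by simp
    then obtain k where "d x (c k) < d x y / 2"
      using dense[OF xy(1), of "d x y / 2"] by auto
    moreover have "d y (c k) = d x (c k)"
      using xy(3) by (simp add: f_def fun_eq_iff)
    ultimately show False
      using triangle[of x "c k" y] xy cM commute by (smt (verit, best) field_sum_of_halves)
  qed
  have f_surj: "\<exists>x\<in>M. f x = y" if "y \<in> Y" for y
  proof -
    have y1: "\<exists>k. y k < 1 / Suc m" and y2: "\<bar>y k - y l\<bar> \<le> d (c k) (c l)"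
      and y3: "d (c k) (c l) \<le> y k + y l" for k l m
      using that by (auto simp: Y_def)
    define s where "s m = (SOME k. y k < 1 / Suc m)" for m
    have s: "y (s m) < 1 / Suc m" for m
      unfolding s_def using y1 by (rule someI_ex)
    have y0: "0 \<le> y k" for k
      using y3[of k k] cM by simp
    have lim0: "(\<lambda>m. y (s m)) \<longlonglongrightarrow> 0"
      by (rule tendsto_sandwich[OF _ _ tendsto_const LIMSEQ_inverse_real_of_nat])
         (use y0 less_imp_le[OF s] in \<open>auto simp: inverse_eq_divide\<close>)
    \<comment> \<open>Along the indices \<open>s m\<close> the distances prescribed by
      \<open>y\<close> tend to 0, so these points should approach the preimage. The bound
      \<open>d (c k) (c l) \<le> y k + y l\<close> makes them Cauchy, and both conditions in
      \<open>Y\<close> together force the limit to have exactly the distances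
      \<open>y\<close>.\<close>
    have "MCauchy (c \<circ> s)"
      unfolding MCauchy_def
    proof (intro conjI allI impI)
      show "range (c \<circ> s) \<subseteq> M" using cM by auto
    next
      fix e :: real assume "e > 0"
      then obtain N where N: "\<And>m. m \<ge> N \<Longrightarrow> y (s m) < e / 2"
        using lim0 order_tendstoD(2)[of _ 0 sequentially "e / 2"]
        by (auto simp: eventually_sequentially)
      have "d ((c \<circ> s) n) ((c \<circ> s) n') < e" if "N \<le> n" "N \<le> n'" for n n'
        using y3[of "s n" "s n'"] N[OF that(1)] N[OF that(2)] by simp
      then show "\<exists>N. \<forall>n n'. N \<le> n \<longrightarrow> N \<le> n' \<longrightarrow> d ((c \<circ> s) n) ((c \<circ> s) n') < e"
        by blast
    qed
    then obtain x where x: "limitin mtopology (c \<circ> s) x sequentially"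
      using compl unfolding mcomplete_def by blast
    then have "x \<in> M"
      by (rule limitin_mspace)
    have lim_x: "(\<lambda>m. d (c (s m)) x) \<longlonglongrightarrow> 0"
      using x by (simp add: limitin_metric_dist_null)
    have "d x (c k) = y k" for k
    proof (rule LIMSEQ_unique)
      have "\<bar>d x (c k) - d (c (s m)) (c k)\<bar> \<le> d (c (s m)) x" for m
        using triangle[of x "c (s m)" "c k"] triangle[of "c (s m)" x "c k"] \<open>x \<in> M\<close> cM
          commute[of x "c (s m)"] by simp
      then have "(\<lambda>m. d x (c k) - d (c (s m)) (c k)) \<longlonglongrightarrow> 0"
        by (intro tendsto_0_le[OF lim_x, of _ 1] always_eventually allI) auto
      then show "(\<lambda>m. d (c (s m)) (c k)) \<longlonglongrightarrow> d x (c k)"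
        by (rule Lim_transform2[OF tendsto_const])
      have "\<bar>y k - d (c (s m)) (c k)\<bar> \<le> y (s m)" for m
        using y2[of "s m" k] y3[of "s m" k] by linarith
      then have "(\<lambda>m. y k - d (c (s m)) (c k)) \<longlonglongrightarrow> 0"
        using y0 by (intro tendsto_0_le[OF lim0, of _ 1] always_eventually allI) auto
      then show "(\<lambda>m. d (c (s m)) (c k)) \<longlonglongrightarrow> y k"
        by (rule Lim_transform2[OF tendsto_const])
    qed
    then show ?thesis
      using \<open>x \<in> M\<close> by (auto simp: f_def)
  qed
  obtain e where e: "e \<in> M"
    using assms(2) M by auto
  \<comment> \<open>Off the Borel set \<open>Y\<close> the value \<open>e\<close> is an arbitrary
    default that makes \<open>r\<close> total and keeps it measurable.\<close>
  define r where "r y = (if y \<in> Y then the_inv_into M f y else e)" for y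
  have inj: "inj_on f M"
    using f_inj by (auto intro: inj_onI)
  have r_f: "r (f x) = x" if "x \<in> M" for x
    using f_Y[OF that] the_inv_into_f_f[OF inj that] by (simp add: r_def)
  have r_Y: "r y \<in> M" "f (r y) = y" if "y \<in> Y" for y
    using f_surj[OF that] r_f by auto
  have "r \<in> ?R \<rightarrow>\<^sub>M E"
  proof (rule measurable_sigma_sets[OF sets_E])
    show "{U. openin mtopology U} \<subseteq> Pow M"
      using openin_subset by fastforce
    show "r \<in> space ?R \<rightarrow> M"
      using r_Y e by (auto simp: r_def)
  next
    fix U assume "U \<in> {U. openin mtopology U}"
    then have U: "openin mtopology U" by simp
    \<comment> \<open>Separability enters here: an open \<open>U\<close> is described by the
      countably many balls of radius \<open>1 / Suc n\<close> around dense points that lie inside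
      it, and membership in such a ball is a condition on a single coordinate of
      \<open>y\<close>.\<close>
    define I where "I = {(k, n). mball (c k) (1 / Suc n) \<subseteq> U}"
    have in_U: "r y \<in> U \<longleftrightarrow> (\<exists>(k, n)\<in>I. y k < 1 / Suc n)" if y: "y \<in> Y" for y
    proof
      assume "r y \<in> U"
      then obtain \<epsilon> where \<epsilon>: "\<epsilon> > 0" "mball (r y) \<epsilon> \<subseteq> U"
        using U unfolding openin_mtopology by blast
      obtain n :: nat where n: "1 / Suc n < \<epsilon> / 2"
        using nat_approx_posE[of "\<epsilon> / 2"] \<epsilon>(1) by auto
      obtain k where k: "d (r y) (c k) < 1 / Suc n"
        using dense[OF r_Y(1)[OF y], of "1 / Suc n"] by auto
      have "mball (c k) (1 / Suc n) \<subseteq> mball (r y) \<epsilon>"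
      proof
        fix z assume "z \<in> mball (c k) (1 / Suc n)"
        then show "z \<in> mball (r y) \<epsilon>"
          using triangle[of "r y" "c k" z] r_Y(1)[OF y] k n by auto
      qed
      then have "(k, n) \<in> I"
        using \<epsilon>(2) by (auto simp: I_def)
      moreover have "y k < 1 / Suc n"
        using k r_Y(2)[OF y] by (metis f_def)
      ultimately show "\<exists>(k, n)\<in>I. y k < 1 / Suc n" by blast
    next
      assume "\<exists>(k, n)\<in>I. y k < 1 / Suc n"
      then obtain k n where "mball (c k) (1 / Suc n) \<subseteq> U" "y k < 1 / Suc n"
        by (auto simp: I_def)
      moreover have "d (r y) (c k) = y k"
        using r_Y(2)[OF y] by (metis f_def)
      ultimately show "r y \<in> U"
        using r_Y(1)[OF y] cM by (auto simp: commute in_mball subset_iff)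
    qed
    have "r y \<in> U \<longleftrightarrow> (if y \<in> Y then \<exists>(k, n)\<in>I. y k < 1 / Suc n else e \<in> U)" for y
      using in_U[of y] by (cases "y \<in> Y") (simp_all add: r_def)
    then have "r -` U \<inter> space ?R =
        {y \<in> space ?R. if y \<in> Y then \<exists>(k, n)\<in>I. y k < 1 / Suc n else e \<in> U}"
      by blast
    also have "\<dots> \<in> sets ?R"
      using Y_sets by measurable
    finally show "r -` U \<inter> space ?R \<in> sets ?R" .
  qed
  then show ?thesis
    unfolding measurable_retract_def using f_meas r_f M by blast
qed

text \<open>Only the digits 0 and 1 occur, so that the base 3 expansion is unique.\<close>

definition ternary :: "(nat \<Rightarrow> bool) \<Rightarrow> real" where
  "ternary b = (\<Sum>m. of_bool (b m) * (1 / 3) ^ Suc m)"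

text \<open>The map \<open>\<lambda>x. frac (3 * x)\<close> is the shift on base 3 expansions; its
  iterates bring digit \<open>m\<close> to the front. This reads a digit off any real number,
  whether or not it is a value of \<open>ternary\<close>.\<close>

definition ternary_digit :: "nat \<Rightarrow> real \<Rightarrow> bool" where
  "ternary_digit m x \<longleftrightarrow> \<lfloor>3 * ((\<lambda>x. frac (3 * x)) ^^ m) x\<rfloor> = 1"

lemma ternary_summable: "summable (\<lambda>m. of_bool (b m) * (1 / 3 :: real) ^ Suc m)"
  by (rule summable_comparison_test'[of "\<lambda>m. (1 / 3 :: real) ^ Suc m" 0])
     (auto simp: of_bool_def summable_mult summable_geometric)

text \<open>The coding rests on 1/2 being below 1: what follows the leading digit never carries over
  into the integer part of \<open>3 * ternary b\<close>, whereas in base 2 a tail of ones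
  would.\<close>

lemma ternary_bounds: "0 \<le> ternary b" "ternary b \<le> 1 / 2"
proof -
  show "0 \<le> ternary b"
    unfolding ternary_def by (rule suminf_nonneg[OF ternary_summable]) simp
  have "(\<lambda>m. (1 / 3 :: real) ^ Suc m) sums (1 / 2)"
    using sums_mult[OF geometric_sums[of "1 / 3 :: real"], of "1 / 3"] by simp
  moreover have "ternary b \<le> (\<Sum>m. (1 / 3) ^ Suc m)"
    unfolding ternary_def
    by (rule suminf_le[OF _ ternary_summable]) (use calculation in \<open>auto simp: sums_iff\<close>)
  ultimately show "ternary b \<le> 1 / 2"
    by (simp add: sums_iff del: power_Suc)
qed

lemma ternary_step: "3 * ternary b = of_bool (b 0) + ternary (b \<circ> Suc)"
proof -
  have "ternary b = of_bool (b 0) / 3 + (\<Sum>m. of_bool (b (Suc m)) * (1 / 3) ^ Suc (Suc m))"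
    unfolding ternary_def using suminf_split_head[OF ternary_summable[of b]] by simp
  also have "(\<Sum>m. of_bool (b (Suc m)) * (1 / 3) ^ Suc (Suc m)) = ternary (b \<circ> Suc) / 3"
    unfolding ternary_def
    using suminf_divide[OF ternary_summable[of "b \<circ> Suc"], of 3] by (simp add: field_simps)
  finally show ?thesis by simp
qed

lemma ternary_digit_ternary: "ternary_digit m (ternary b) = b m"
proof -
  have fl: "\<lfloor>3 * ternary b\<rfloor> = of_bool (b 0)" for b
    using ternary_bounds[of "b \<circ> Suc"] unfolding ternary_step by (auto simp: floor_eq_iff)
  have "((\<lambda>x. frac (3 * x)) ^^ m) (ternary b) = ternary (\<lambda>k. b (k + m))"
  proof (induction m)
    case (Suc m)
    then show ?case
      using fl[of "\<lambda>k. b (k + m)"] ternary_step[of "\<lambda>k. b (k + m)"] by (simp add: frac_def o_def)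
  qed simp
  then show ?thesis
    using fl[of "\<lambda>k. b (k + m)"] by (simp add: ternary_digit_def)
qed

lemma measurable_ternary_digit [measurable]: "Measurable.pred borel (ternary_digit m)"
proof -
  have "(\<lambda>x::real. frac x) \<in> borel_measurable borel"
    unfolding frac_def by measurable
  note [measurable] = measurable_compose[OF _ this]
  have "((\<lambda>x::real. frac (3 * x)) ^^ m) \<in> borel_measurable borel"
  proof (induction m)
    case (Suc m)
    note [measurable] = this
    show ?case by (simp add: o_def)
  qed (simp add: id_def)
  note [measurable] = this
  show ?thesis
    unfolding ternary_digit_def by measurable
qed

text \<open>A real number is the infimum of the rationals above it. Writing \<infinity> for the
  other rationals keeps the infimum over all \<open>k\<close>, so that it can be formed from any
  sequence of bits, even one that is not a cut.\<close>

lemma INF_upper_rationals: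
  "(INF k. if x < real_of_rat (nat_to_rat_surj k) then ereal (real_of_rat (nat_to_rat_surj k)) else \<infinity>)
    = ereal x"
proof (rule INF_eqI)
  fix y assume y: "\<And>k. k \<in> UNIV \<Longrightarrow> y \<le>
    (if x < real_of_rat (nat_to_rat_surj k) then ereal (real_of_rat (nat_to_rat_surj k)) else \<infinity>)"
  show "y \<le> ereal x"
  proof (rule dense_ge)
    fix z assume "ereal x < z"
    then obtain z' where z': "ereal x < ereal z'" "ereal z' < z"
      using ereal_dense2 by blast
    then obtain q where q: "x < real_of_rat q" "real_of_rat q < z'"
      using of_rat_dense[of x z'] by auto
    obtain k where "q = nat_to_rat_surj k"
      using surj_nat_to_rat_surj by (metis surjD)
    then have "y \<le> ereal (real_of_rat q)"
      using y[of k] q(1) by simp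
    also have "\<dots> \<le> ereal z'"
      using q(2) by simp
    also have "\<dots> \<le> z"
      using z'(2) by simp
    finally show "y \<le> z" .
  qed
qed auto

text \<open>Countably many coordinates with countably many cut bits each are still countably many
  bits. \<open>prod_encode\<close> interleaves them, one real number stores them, and decoding
  rebuilds each coordinate as the infimum of its upper cut.\<close>

lemma PiM_borel_measurable_retract:
  fixes S :: "'i set"
  assumes "countable S"
  shows "measurable_retract (PiM S (\<lambda>_. borel :: real measure)) (restrict_space borel {0..1::real})"
proof -
  let ?M = "PiM S (\<lambda>_. borel :: real measure)"
  let ?q = "\<lambda>k. real_of_rat (nat_to_rat_surj k)"
  \<comment> \<open>Numbers \<open>j\<close> that enumerate no site, which occur when
    \<open>S\<close> is finite, contribute the bit \<open>False\<close>.\<close>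
  define b where
    "b \<omega> m = (case prod_decode m of (j, k) \<Rightarrow>
       j \<in> to_nat_on S ` S \<and> \<omega> (from_nat_into S j) < ?q k)" for \<omega> :: "'i \<Rightarrow> real" and m
  \<comment> \<open>Bits that do not come from a configuration may give an infinite infimum;
    \<open>real_of_ereal\<close> sends it to 0.\<close>
  define \<rho> where
    "\<rho> x = (\<lambda>i\<in>S. real_of_ereal (INF k. if ternary_digit (prod_encode (to_nat_on S i, k)) x
       then ereal (?q k) else \<infinity>))" for x
  have [measurable]: "Measurable.pred ?M (\<lambda>\<omega>. b \<omega> m)" for m
  proof (cases "fst (prod_decode m) \<in> to_nat_on S ` S")
    case True
    then have [measurable]: "from_nat_into S (fst (prod_decode m)) \<in> S"
      using assms by auto
    show ?thesis
      unfolding b_def split_beta by measurable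
  qed (auto simp: b_def split_beta)
  have "(\<lambda>\<omega>. ternary (b \<omega>)) \<in> ?M \<rightarrow>\<^sub>M restrict_space borel {0..1}"
  proof (rule measurable_restrict_space2)
    show "(\<lambda>\<omega>. ternary (b \<omega>)) \<in> borel_measurable ?M"
      unfolding ternary_def by measurable
    show "(\<lambda>\<omega>. ternary (b \<omega>)) \<in> space ?M \<rightarrow> {0..1}"
      using ternary_bounds(1) order_trans[OF ternary_bounds(2)] by auto
  qed
  moreover have "\<rho> \<in> restrict_space borel {0..1} \<rightarrow>\<^sub>M ?M"
    by (rule measurable_restrict_space1) (unfold \<rho>_def, measurable)
  moreover have "\<rho> (ternary (b \<omega>)) = \<omega>" if \<omega>: "\<omega> \<in> space ?M" for \<omega>
  proof
    fix i
    show "\<rho> (ternary (b \<omega>)) i = \<omega> i"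
    proof (cases "i \<in> S")
      case True
      then have "b \<omega> (prod_encode (to_nat_on S i, k)) \<longleftrightarrow> \<omega> i < ?q k" for k
        using assms by (simp add: b_def)
      then have "\<rho> (ternary (b \<omega>)) i =
          real_of_ereal (INF k. if \<omega> i < ?q k then ereal (?q k) else \<infinity>)"
        using True by (simp only: \<rho>_def restrict_apply' ternary_digit_ternary)
      then show ?thesis
        by (simp only: INF_upper_rationals real_of_ereal.simps)
    next
      case False
      then show ?thesis
        using \<omega> by (simp add: \<rho>_def space_PiM PiE_iff extensional_def)
    qed
  qed
  ultimately show ?thesis
    unfolding measurable_retract_def by (meson bexI)
qed

lemma measurable_retract_restrictE:
  assumes "measurable_retract M (restrict_space borel {0..1::real})"
  obtains \<phi> :: "'a \<Rightarrow> real" and \<rho> where "\<phi> \<in> borel_measurable M" "\<rho> \<in> borel \<rightarrow>\<^sub>M M"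
    "\<And>x. x \<in> space M \<Longrightarrow> \<phi> x \<in> {0..1}" "\<And>x. x \<in> space M \<Longrightarrow> \<rho> (\<phi> x) = x"
proof -
  let ?I = "restrict_space borel {0..1::real}"
  obtain \<phi> \<rho> where \<phi>: "\<phi> \<in> M \<rightarrow>\<^sub>M ?I" and \<rho>: "\<rho> \<in> ?I \<rightarrow>\<^sub>M M"
    and inv: "\<And>x. x \<in> space M \<Longrightarrow> \<rho> (\<phi> x) = x"
    using assms unfolding measurable_retract_def by blast
  \<comment> \<open>Clamping extends \<rho> from the interval to the line, so that every Borel
    measure on the line can be pushed along it.\<close>
  have "(\<lambda>x::real. max 0 (min 1 x)) \<in> borel \<rightarrow>\<^sub>M ?I"
    by (rule measurable_restrict_space2) auto
  then have \<rho>': "(\<lambda>x. \<rho> (max 0 (min 1 x))) \<in> borel \<rightarrow>\<^sub>M M"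
    using \<rho> by (rule measurable_compose)
  have range: "\<phi> x \<in> {0..1}" if "x \<in> space M" for x
    using measurable_space[OF \<phi> that] by (simp add: space_restrict_space)
  show thesis
    using \<phi> \<rho>' range inv by (intro that[of \<phi> "\<lambda>x. \<rho> (max 0 (min 1 x))"]) (auto simp: measurable_restrict_space2_iff)
qed

lemma config_space_measurable_retract:
  fixes S :: "'i set" and E :: "'e measure"
  assumes "countable S" "standard_borel E" "space (config_space S E) \<noteq> {}"
  shows "measurable_retract (config_space S E) (restrict_space borel {0..1::real})"
\<comment> \<open>For empty \<open>S\<close> the product is a single point whatever \<open>E\<close>
  is. Otherwise a configuration supplies a point of \<open>E\<close>, which the embedding of
  \<open>E\<close> requires.\<close>
proof (cases "S = {}")
  case True
  then show ?thesis
    unfolding measurable_retract_def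
    by (intro bexI[of _ "\<lambda>_. 0"] bexI[of _ "\<lambda>_ _. undefined"])
       (auto simp: space_PiM measurable_restrict_space2_iff)
next
  case False
  then have "space E \<noteq> {}"
    using assms(3) by (force simp: space_PiM)
  let ?R = "PiM (UNIV :: nat set) (\<lambda>_. borel :: real measure)"
  \<comment> \<open>Returning from the interval to the line makes \<open>E\<close> a retract of the
    very factor \<open>borel\<close> that the product coding accepts.\<close>
  have "measurable_retract (restrict_space borel {0..1::real}) (borel :: real measure)"
    unfolding measurable_retract_def
    by (rule bexI[of _ "\<lambda>x :: real. x"], rule bexI[of _ "\<lambda>x :: real. max 0 (min 1 x)"])
       (auto simp: space_restrict_space measurable_restrict_space1 measurable_restrict_space2_iff)
  then have "measurable_retract E (borel :: real measure)"
    using standard_borel_measurable_retract[OF assms(2) \<open>space E \<noteq> {}\<close>]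
      PiM_borel_measurable_retract[of "UNIV :: nat set"]
    by (blast intro: measurable_retract_trans)
  then show ?thesis
    using PiM_borel_measurable_retract[OF assms(1)] measurable_retract_PiM measurable_retract_trans
    by blast
qed

subsection \<open>Convergence of reverse martingales\<close>

text \<open>This is Kolmogorov's inequality with time reversed. \<open>orth\<close> is the
  martingale property against bounded test functions, and the bound 2 fits differences of two values
  in [-1, 1]. The right side is the second moment of \<open>X m - X N\<close>, an increment
  orthogonal to \<open>X N\<close>.\<close>

lemma (in prob_space) reverse_martingale_maximal_inequality:
  fixes X :: "nat \<Rightarrow> 'a \<Rightarrow> real"
  assumes subalg: "\<And>n. subalgebra M (F n)"
    and decr: "\<And>m n. m \<le> n \<Longrightarrow> sets (F n) \<subseteq> sets (F m)"
    and X_meas: "\<And>n. X n \<in> borel_measurable (F n)"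
    and X_bound: "\<And>n x. x \<in> space M \<Longrightarrow> \<bar>X n x\<bar> \<le> 1"
    and orth: "\<And>n m h. m \<le> n \<Longrightarrow> h \<in> borel_measurable (F n) \<Longrightarrow> (\<And>x. x \<in> space M \<Longrightarrow> \<bar>h x\<bar> \<le> 2)
      \<Longrightarrow> (\<integral>x. h x * X m x \<partial>M) = (\<integral>x. h x * X n x \<partial>M)"
    and "m \<le> N" "\<epsilon> > 0"
  shows "\<epsilon>\<^sup>2 * prob {x \<in> space M. \<exists>n\<in>{m..N}. \<epsilon> \<le> \<bar>X n x - X N x\<bar>}
    \<le> (\<integral>x. (X m x)\<^sup>2 \<partial>M) - (\<integral>x. (X N x)\<^sup>2 \<partial>M)"
proof -
  have X_F: "X k \<in> borel_measurable (F n)" if "n \<le> k" for n k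
    using X_meas[of k] decr[OF that] subalg
    by (metis measurable_from_subalg subalgebra_def)
  have [measurable]: "X n \<in> borel_measurable M" for n
    using X_meas subalg measurable_from_subalg by blast
  have diff_bound: "\<bar>X n x - X k x\<bar> \<le> 2" if "x \<in> space M" for n k x
    using X_bound[OF that, of n] X_bound[OF that, of k] by linarith
  have int: "integrable M (\<lambda>x. h x * X n x)"
    if "h \<in> borel_measurable M" "\<And>x. x \<in> space M \<Longrightarrow> \<bar>h x\<bar> \<le> 2" for h n
  proof (rule integrable_const_bound[where B = 2])
    show "AE x in M. norm (h x * X n x) \<le> 2"
      using mult_mono[OF that(2) X_bound] by (intro AE_I2) (simp add: abs_mult)
  qed (use that in measurable)
  have int2: "integrable M (\<lambda>x. indicator D x * (X n x - X k x)\<^sup>2)" if "D \<in> sets M" for n k D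
  proof (rule integrable_const_bound[where B = 4])
    have "(X n x - X k x)\<^sup>2 \<le> 4" if "x \<in> space M" for x
      using power_mono[OF diff_bound[OF that, of n k], of 2] by simp
    then show "AE x in M. norm (indicator D x * (X n x - X k x)\<^sup>2) \<le> 4"
      by (intro AE_I2) (auto simp: indicator_def)
  qed (use that in measurable)
  \<comment> \<open>On an event of \<open>F n\<close>, the difference \<open>X n - X N\<close> is
    the projection of \<open>X m - X N\<close> onto \<open>F n\<close>, and projecting does not
    increase second moments.\<close>
  have proj: "(\<integral>x. indicator D x * (X n x - X N x)\<^sup>2 \<partial>M) \<le> (\<integral>x. indicator D x * (X m x - X N x)\<^sup>2 \<partial>M)"
    if D: "D \<in> sets (F n)" and n: "m \<le> n" "n \<le> N" for D n
  proof -
    let ?h = "\<lambda>x. indicator D x * (X n x - X N x)"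
    have h: "?h \<in> borel_measurable (F n)"
      using D X_F[of n n] X_F[OF n(2)] by measurable
    have hb: "\<bar>?h x\<bar> \<le> 2" if "x \<in> space M" for x
      using diff_bound[OF that, of n N] by (simp add: indicator_def)
    have DM: "D \<in> sets M"
      using D subalg by (auto simp: subalgebra_def)
    have hM: "?h \<in> borel_measurable M"
      using DM by measurable
    have "0 \<le> (\<integral>x. indicator D x * (X m x - X n x)\<^sup>2 \<partial>M)"
      by (rule integral_nonneg_AE) auto
    \<comment> \<open>This is (a - b)^2 = a^2 - b^2 - 2 b (a - b) with \<open>a = X m - X N\<close>
      and \<open>b = X n - X N\<close>; the last term has mean 0 by \<open>orth\<close>.\<close>
    also have "\<dots> = (\<integral>x. indicator D x * (X m x - X N x)\<^sup>2 - indicator D x * (X n x - X N x)\<^sup>2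
        - (2 * (?h x * X m x) - 2 * (?h x * X n x)) \<partial>M)"
      by (rule Bochner_Integration.integral_cong) (auto simp: power2_eq_square algebra_simps)
    also have "\<dots> = (\<integral>x. indicator D x * (X m x - X N x)\<^sup>2 \<partial>M) - (\<integral>x. indicator D x * (X n x - X N x)\<^sup>2 \<partial>M)
        - (2 * (\<integral>x. ?h x * X m x \<partial>M) - 2 * (\<integral>x. ?h x * X n x \<partial>M))"
      using int2[OF DM] int[OF hM hb]
      by (simp add: Bochner_Integration.integral_diff)
    also have "\<dots> = (\<integral>x. indicator D x * (X m x - X N x)\<^sup>2 \<partial>M) - (\<integral>x. indicator D x * (X n x - X N x)\<^sup>2 \<partial>M)"
      using orth[OF n(1) h hb] by simp
    finally show ?thesis by simp
  qed
  \<comment> \<open>Here \<open>n\<close> is the last index with a large deviation. Only indices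
    from \<open>n\<close> on are involved, so the event lies in \<open>F n\<close>; with the first
    such index this would fail in general.\<close>
  define D where "D n = {x \<in> space M. \<epsilon> \<le> \<bar>X n x - X N x\<bar> \<and> (\<forall>k\<in>{n<..N}. \<bar>X k x - X N x\<bar> < \<epsilon>)}" for n
  have D_F: "D n \<in> sets (F n)" if "n \<le> N" for n
  proof -
    have [measurable]: "X n \<in> borel_measurable (F n)" "X N \<in> borel_measurable (F n)"
      using X_F that by auto
    have "{x \<in> space (F n). \<bar>X k x - X N x\<bar> < \<epsilon>} \<in> sets (F n)" if "k \<in> {n<..N}" for k
    proof -
      have [measurable]: "X k \<in> borel_measurable (F n)"
        using X_F that by simp
      show ?thesis by measurable
    qed
    then have "{x \<in> space (F n). \<forall>k\<in>{n<..N}. \<bar>X k x - X N x\<bar> < \<epsilon>} \<in> sets (F n)"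
      by (intro sets.sets_Collect_finite_All) auto
    moreover have "{x \<in> space (F n). \<epsilon> \<le> \<bar>X n x - X N x\<bar>} \<in> sets (F n)"
      by measurable
    ultimately have "{x \<in> space (F n). \<epsilon> \<le> \<bar>X n x - X N x\<bar> \<and> (\<forall>k\<in>{n<..N}. \<bar>X k x - X N x\<bar> < \<epsilon>)}
        \<in> sets (F n)"
      by (intro sets.sets_Collect_conj)
    moreover have space: "space (F n) = space M"
      using subalg by (simp add: subalgebra_def)
    ultimately show ?thesis
      by (simp only: D_def space)
  qed
  have D_M: "D n \<in> sets M" if "n \<le> N" for n
    using D_F[OF that] subalg by (auto simp: subalgebra_def)
  have "D j \<inter> D k = {}" if "j < k" "k \<le> N" for j k
    using that by (force simp: D_def)
  then have disj: "disjoint_family_on D {m..N}"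
    unfolding disjoint_family_on_def by (metis Int_commute atLeastAtMost_iff nat_neq_iff)
  have union: "{x \<in> space M. \<exists>n\<in>{m..N}. \<epsilon> \<le> \<bar>X n x - X N x\<bar>} = (\<Union>n\<in>{m..N}. D n)"
  proof (intro equalityI subsetI)
    fix x assume "x \<in> {x \<in> space M. \<exists>n\<in>{m..N}. \<epsilon> \<le> \<bar>X n x - X N x\<bar>}"
    then have x: "x \<in> space M" and ne: "{n\<in>{m..N}. \<epsilon> \<le> \<bar>X n x - X N x\<bar>} \<noteq> {}"
      by auto
    define n where "n = Max {n\<in>{m..N}. \<epsilon> \<le> \<bar>X n x - X N x\<bar>}"
    have "n \<in> {n\<in>{m..N}. \<epsilon> \<le> \<bar>X n x - X N x\<bar>}"
      unfolding n_def using ne by (intro Max_in) auto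
    moreover have "\<bar>X k x - X N x\<bar> < \<epsilon>" if "k \<in> {n<..N}" for k
    proof (rule ccontr)
      assume "\<not> \<bar>X k x - X N x\<bar> < \<epsilon>"
      then have "k \<le> n"
        unfolding n_def using that calculation by (intro Max_ge) auto
      then show False using that by simp
    qed
    ultimately show "x \<in> (\<Union>n\<in>{m..N}. D n)"
      using x by (auto simp: D_def)
  qed (auto simp: D_def)
  have "\<epsilon>\<^sup>2 * prob (\<Union>n\<in>{m..N}. D n) = (\<Sum>n\<in>{m..N}. \<epsilon>\<^sup>2 * prob (D n))"
    using disj D_M by (subst finite_measure_finite_Union) (auto simp: sum_distrib_left)
  also have "\<dots> \<le> (\<Sum>n\<in>{m..N}. \<integral>x. indicator (D n) x * (X m x - X N x)\<^sup>2 \<partial>M)"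
  proof (rule sum_mono)
    fix n assume n: "n \<in> {m..N}"
    have "\<epsilon>\<^sup>2 * prob (D n) = (\<integral>x. indicator (D n) x * \<epsilon>\<^sup>2 \<partial>M)"
      using D_M[of n] n by simp
    also have "\<dots> \<le> (\<integral>x. indicator (D n) x * (X n x - X N x)\<^sup>2 \<partial>M)"
    proof (rule integral_mono)
      show "integrable M (\<lambda>x. indicator (D n) x * \<epsilon>\<^sup>2)"
        using D_M[of n] n by (simp add: less_top[symmetric])
      show "integrable M (\<lambda>x. indicator (D n) x * (X n x - X N x)\<^sup>2)"
        using D_M[of n] n by (intro int2) auto
      fix x
      show "indicator (D n) x * \<epsilon>\<^sup>2 \<le> indicator (D n) x * (X n x - X N x)\<^sup>2"
        using \<open>\<epsilon> > 0\<close> by (auto simp: indicator_def D_def abs_le_square_iff[symmetric])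
    qed
    also have "\<dots> \<le> (\<integral>x. indicator (D n) x * (X m x - X N x)\<^sup>2 \<partial>M)"
      using n D_F by (intro proj) auto
    finally show "\<epsilon>\<^sup>2 * prob (D n) \<le> (\<integral>x. indicator (D n) x * (X m x - X N x)\<^sup>2 \<partial>M)" .
  qed
  also have "\<dots> = (\<integral>x. (\<Sum>n\<in>{m..N}. indicator (D n) x * (X m x - X N x)\<^sup>2) \<partial>M)"
    using D_M by (subst Bochner_Integration.integral_sum) (auto intro!: int2)
  also have "\<dots> \<le> (\<integral>x. indicator (space M) x * (X m x - X N x)\<^sup>2 \<partial>M)"
  proof (rule integral_mono)
    show "integrable M (\<lambda>x. \<Sum>n\<in>{m..N}. indicator (D n) x * (X m x - X N x)\<^sup>2)"
      using D_M by (intro Bochner_Integration.integrable_sum int2) auto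
    fix x assume x: "x \<in> space M"
    have "(\<Sum>n\<in>{m..N}. indicator (D n) x) = (indicator (\<Union>n\<in>{m..N}. D n) x :: real)"
      using disj by (simp add: indicator_UN_disjoint)
    also have "\<dots> \<le> 1"
      by (simp add: indicator_def)
    finally show "(\<Sum>n\<in>{m..N}. indicator (D n) x * (X m x - X N x)\<^sup>2)
        \<le> indicator (space M) x * (X m x - X N x)\<^sup>2"
      using x by (simp add: sum_distrib_right[symmetric] mult_left_le_one_le sum_nonneg)
  qed (auto intro!: int2)
  also have "\<dots> = (\<integral>x. X m x * X m x - 2 * (X N x * X m x) + X N x * X N x \<partial>M)"
    by (rule Bochner_Integration.integral_cong) (auto simp: power2_eq_square algebra_simps)
  also have "\<dots> = (\<integral>x. X m x * X m x \<partial>M) - 2 * (\<integral>x. X N x * X m x \<partial>M) + (\<integral>x. X N x * X N x \<partial>M)"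
    using X_bound by (simp add: int order_trans[OF X_bound])
  also have "(\<integral>x. X N x * X m x \<partial>M) = (\<integral>x. X N x * X N x \<partial>M)"
    using X_bound by (intro orth \<open>m \<le> N\<close> X_meas) (simp add: order_trans[OF X_bound])
  finally show ?thesis
    unfolding union by (simp add: power2_eq_square)
qed

text \<open>Second moments decrease along a reverse martingale and hence converge, and the maximal
  inequality bounds the oscillation after index \<open>m\<close> by what is left of this decrease.
  So the sequence is almost surely Cauchy.\<close>

lemma (in prob_space) reverse_martingale_AE_convergent:
  fixes X :: "nat \<Rightarrow> 'a \<Rightarrow> real"
  assumes subalg: "\<And>n. subalgebra M (F n)"
    and decr: "\<And>m n. m \<le> n \<Longrightarrow> sets (F n) \<subseteq> sets (F m)"
    and X_meas: "\<And>n. X n \<in> borel_measurable (F n)"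
    and X_bound: "\<And>n x. x \<in> space M \<Longrightarrow> \<bar>X n x\<bar> \<le> 1"
    and "integrable M f"
    and X_cond: "\<And>n A. A \<in> sets (F n) \<Longrightarrow> (\<integral>x\<in>A. X n x \<partial>M) = (\<integral>x\<in>A. f x \<partial>M)"
  shows "AE x in M. convergent (\<lambda>n. X n x)"
proof -
  note [measurable] = borel_measurable_integrable[OF \<open>integrable M f\<close>]
  have [measurable]: "X n \<in> borel_measurable M" for n
    using X_meas subalg measurable_from_subalg by blast
  have int_X: "integrable M (X n)" for n
    using X_bound by (intro integrable_const_bound[where B = 1]) auto
  have cond: "(\<integral>x. h x * X n x \<partial>M) = (\<integral>x. h x * f x \<partial>M)"
    if h: "h \<in> borel_measurable (F n)" and hb: "\<And>x. x \<in> space M \<Longrightarrow> \<bar>h x\<bar> \<le> 2" for n h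
  proof -
    interpret finite_measure_subalgebra M "F n"
      by unfold_locales (rule subalg)
    have [measurable]: "h \<in> borel_measurable M"
      using h subalg measurable_from_subalg by blast
    have "integrable M (\<lambda>x. h x * f x)"
    proof (rule Bochner_Integration.integrable_bound[where f = "\<lambda>x. 2 * f x"])
      show "AE x in M. norm (h x * f x) \<le> norm (2 * f x)"
        using hb by (intro AE_I2) (simp add: abs_mult mult_right_mono)
    qed (use \<open>integrable M f\<close> in auto)
    then have "(\<integral>x. h x * f x \<partial>M) = (\<integral>x. h x * real_cond_exp M (F n) f x \<partial>M)"
      using h by (simp add: real_cond_exp_intg)
    also have "AE x in M. real_cond_exp M (F n) f x = X n x"
      by (rule real_cond_exp_charact) (auto simp: X_cond X_meas int_X \<open>integrable M f\<close>)
    then have "(\<integral>x. h x * real_cond_exp M (F n) f x \<partial>M) = (\<integral>x. h x * X n x \<partial>M)"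
      by (intro integral_cong_AE) auto
    finally show ?thesis ..
  qed
  define e where "e n = (\<integral>x. (X n x)\<^sup>2 \<partial>M)" for n
  have maximal: "\<epsilon>\<^sup>2 * prob {x \<in> space M. \<exists>n\<in>{m..N}. \<epsilon> \<le> \<bar>X n x - X N x\<bar>} \<le> e m - e N"
    if "m \<le> N" "\<epsilon> > 0" for m N \<epsilon>
    unfolding e_def
  proof (rule reverse_martingale_maximal_inequality[where F = F])
    fix n m :: nat and h :: "'a \<Rightarrow> real"
    assume "m \<le> n" and h: "h \<in> borel_measurable (F n)" "\<And>x. x \<in> space M \<Longrightarrow> \<bar>h x\<bar> \<le> 2"
    have "h \<in> borel_measurable (F m)"
      using h(1) decr[OF \<open>m \<le> n\<close>] subalg by (metis measurable_from_subalg subalgebra_def)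
    then show "(\<integral>x. h x * X m x \<partial>M) = (\<integral>x. h x * X n x \<partial>M)"
      using h cond by simp
  qed (use that assms in auto)
  \<comment> \<open>Monotonicity is the maximal inequality with its left side bounded below by
    0.\<close>
  have "decseq e"
    unfolding decseq_def
  proof (intro allI impI)
    fix m n :: nat assume "m \<le> n"
    then show "e n \<le> e m"
      using order_trans[OF measure_nonneg maximal[of m n 1, simplified]] by simp
  qed
  moreover have "0 \<le> e n" for n
    unfolding e_def by (rule integral_nonneg_AE) auto
  ultimately obtain l where l: "e \<longlonglongrightarrow> l" "\<And>n. l \<le> e n"
    using decseq_convergent[of e 0] by auto
  \<comment> \<open>The factor 2 arises because two terms that are \<open>2 * \<epsilon>\<close>
    apart cannot both be closer than \<epsilon> to a common last term.\<close>
  define V where "V \<epsilon> m = {x \<in> space M. \<exists>j\<ge>m. \<exists>k\<ge>m. 2 * \<epsilon> \<le> \<bar>X j x - X k x\<bar>}" for \<epsilon> m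
  have V_sets [measurable]: "V \<epsilon> m \<in> sets M" for \<epsilon> m
    unfolding V_def by measurable
  have V_le: "\<epsilon>\<^sup>2 * prob (V \<epsilon> m) \<le> e m - l" if "\<epsilon> > 0" for \<epsilon> m
  proof -
    \<comment> \<open>The maximal inequality needs a last index, so the oscillation is cut off at
      \<open>m + N\<close> before \<open>N\<close> grows.\<close>
    define W where "W N = {x \<in> space M. \<exists>j\<in>{m..m + N}. \<exists>k\<in>{m..m + N}. 2 * \<epsilon> \<le> \<bar>X j x - X k x\<bar>}" for N
    have [measurable]: "W N \<in> sets M" for N
      unfolding W_def by measurable
    have V_UN: "V \<epsilon> m = (\<Union>N. W N)"
    proof (intro equalityI subsetI)
      fix x assume "x \<in> V \<epsilon> m"
      then obtain j k where "x \<in> space M" "j \<ge> m" "k \<ge> m" "2 * \<epsilon> \<le> \<bar>X j x - X k x\<bar>"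
        by (auto simp: V_def)
      moreover from this have "j \<in> {m..m + (j + k)}" "k \<in> {m..m + (j + k)}"
        by auto
      ultimately have "x \<in> W (j + k)"
        unfolding W_def by blast
      then show "x \<in> (\<Union>N. W N)" by blast
    next
      fix x assume "x \<in> (\<Union>N. W N)"
      then obtain N j k where "x \<in> space M" "2 * \<epsilon> \<le> \<bar>X j x - X k x\<bar>"
        and "j \<in> {m..m + N}" "k \<in> {m..m + N}"
        unfolding W_def by blast
      moreover from this have "j \<ge> m" "k \<ge> m"
        by auto
      ultimately show "x \<in> V \<epsilon> m"
        unfolding V_def by blast
    qed
    have "incseq W"
      by (intro incseq_SucI) (fastforce simp: W_def)
    then have "(\<lambda>N. \<epsilon>\<^sup>2 * prob (W N)) \<longlonglongrightarrow> \<epsilon>\<^sup>2 * prob (V \<epsilon> m)"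
      unfolding V_UN by (intro tendsto_mult_left finite_Lim_measure_incseq) auto
    moreover have "\<epsilon>\<^sup>2 * prob (W N) \<le> e m - l" for N
    proof -
      have "W N \<subseteq> {x \<in> space M. \<exists>n\<in>{m..m + N}. \<epsilon> \<le> \<bar>X n x - X (m + N) x\<bar>}"
      proof
        fix x assume "x \<in> W N"
        then obtain j k where x: "x \<in> space M" and jk: "j \<in> {m..m + N}" "k \<in> {m..m + N}"
          and "2 * \<epsilon> \<le> \<bar>X j x - X k x\<bar>"
          unfolding W_def by blast
        then have "\<epsilon> \<le> \<bar>X j x - X (m + N) x\<bar> \<or> \<epsilon> \<le> \<bar>X k x - X (m + N) x\<bar>"
          by linarith
        then show "x \<in> {x \<in> space M. \<exists>n\<in>{m..m + N}. \<epsilon> \<le> \<bar>X n x - X (m + N) x\<bar>}"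
          using x jk by blast
      qed
      then have "prob (W N) \<le> prob {x \<in> space M. \<exists>n\<in>{m..m + N}. \<epsilon> \<le> \<bar>X n x - X (m + N) x\<bar>}"
        by (intro finite_measure_mono) measurable
      then have "\<epsilon>\<^sup>2 * prob (W N) \<le>
          \<epsilon>\<^sup>2 * prob {x \<in> space M. \<exists>n\<in>{m..m + N}. \<epsilon> \<le> \<bar>X n x - X (m + N) x\<bar>}"
        by (rule mult_left_mono) simp
      also have "\<dots> \<le> e m - e (m + N)"
        using that by (intro maximal) auto
      finally show ?thesis
        using l(2)[of "m + N"] by simp
    qed
    ultimately show ?thesis
      by (intro LIMSEQ_le_const2) auto
  qed
  have null: "AE x in M. x \<notin> (\<Inter>m. V (1 / Suc i) m)" for i
  proof -
    let ?\<epsilon> = "1 / real (Suc i)"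
    have "?\<epsilon>\<^sup>2 * prob (\<Inter>m. V ?\<epsilon> m) \<le> e n - l" for n
    proof -
      have "prob (\<Inter>m. V ?\<epsilon> m) \<le> prob (V ?\<epsilon> n)"
        by (intro finite_measure_mono) auto
      then have "?\<epsilon>\<^sup>2 * prob (\<Inter>m. V ?\<epsilon> m) \<le> ?\<epsilon>\<^sup>2 * prob (V ?\<epsilon> n)"
        by (rule mult_left_mono) simp
      also have "\<dots> \<le> e n - l"
        by (rule V_le) simp
      finally show ?thesis .
    qed
    moreover have "(\<lambda>n. e n - l) \<longlonglongrightarrow> 0"
      using l(1) by (simp add: LIM_zero)
    ultimately have "?\<epsilon>\<^sup>2 * prob (\<Inter>m. V ?\<epsilon> m) \<le> 0"
      by (intro LIMSEQ_le_const) auto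
    then have "prob (\<Inter>m. V ?\<epsilon> m) = 0"
      using measure_nonneg[of M "\<Inter>m. V ?\<epsilon> m"] by (simp add: mult_le_0_iff order_antisym)
    then have "(\<Inter>m. V ?\<epsilon> m) \<in> null_sets M"
      by (intro null_setsI) (auto simp: emeasure_eq_measure)
    then show ?thesis
      by (rule AE_not_in)
  qed
  have "AE x in M. \<forall>i. x \<notin> (\<Inter>m. V (1 / Suc i) m)"
    using null by (simp add: AE_all_countable)
  with AE_space show ?thesis
  proof eventually_elim
    case (elim x)
    have "Cauchy (\<lambda>n. X n x)"
    proof (rule metric_CauchyI)
      fix r :: real assume "r > 0"
      then obtain i where i: "1 / Suc i < r / 2"
        using nat_approx_posE[of "r / 2"] by auto
      obtain m where "x \<notin> V (1 / Suc i) m"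
        using elim(2) by blast
      then have "\<bar>X j x - X k x\<bar> < 2 * (1 / Suc i)" if "j \<ge> m" "k \<ge> m" for j k
        using that elim(1) unfolding V_def by (smt (verit, best) mem_Collect_eq)
      then show "\<exists>m. \<forall>j\<ge>m. \<forall>k\<ge>m. dist (X j x) (X k x) < r"
        using i by (intro exI[of _ m]) (force simp: dist_real_def)
    qed
    then show ?case
      by (rule Cauchy_convergent)
  qed
qed

subsection \<open>Limits of measures through distribution functions\<close>

definition sublevel :: "'a measure \<Rightarrow> ('a \<Rightarrow> real) \<Rightarrow> real \<Rightarrow> 'a set" where
  "sublevel M \<phi> x = {\<omega> \<in> space M. \<phi> \<omega> \<le> x}"

lemma sets_sublevel [measurable]: "\<phi> \<in> borel_measurable M \<Longrightarrow> sublevel M \<phi> x \<in> sets M"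
  unfolding sublevel_def by measurable

text \<open>
  The lower limit makes this a distribution function even when the measures do not converge, and
  the infimum makes it right continuous; hence the limit kernel is defined everywhere.
\<close>

definition limit_cdf :: "'a measure \<Rightarrow> ('a \<Rightarrow> real) \<Rightarrow> (nat \<Rightarrow> 'a measure) \<Rightarrow> real \<Rightarrow> ennreal" where
  "limit_cdf M \<phi> s x = (INF k::nat. liminf (\<lambda>n. emeasure (s n) (sublevel M \<phi> (x + 1 / Suc k))))"

definition limit_measure ::
    "'a measure \<Rightarrow> ('a \<Rightarrow> real) \<Rightarrow> (real \<Rightarrow> 'a) \<Rightarrow> (nat \<Rightarrow> 'a measure) \<Rightarrow> 'a measure" where
  "limit_measure M \<phi> \<rho> s = distr (interval_measure (\<lambda>x. enn2real (limit_cdf M \<phi> s x))) M \<rho>"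

text \<open>A lower limit ignores finitely many terms. This is what makes the limit kernel tail
  measurable.\<close>

lemma limit_measure_shift: "limit_measure M \<phi> \<rho> (\<lambda>n. s (n + m)) = limit_measure M \<phi> \<rho> s"
proof -
  have "liminf (\<lambda>n. emeasure (s (n + m)) A) = liminf (\<lambda>n. emeasure (s n) A)" for A
    by (rule liminf_shift_k[of "\<lambda>n. emeasure (s n) A"])
  then show ?thesis
    by (simp only: limit_measure_def limit_cdf_def)
qed

locale unit_sequence =
  fixes M :: "'a measure" and \<phi> :: "'a \<Rightarrow> real" and s :: "nat \<Rightarrow> 'a measure"
  assumes \<phi>_meas [measurable]: "\<phi> \<in> borel_measurable M"
    and \<phi>_range: "\<And>\<omega>. \<omega> \<in> space M \<Longrightarrow> \<phi> \<omega> \<in> {0..1}"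
    and s_prob: "\<And>n. s n \<in> space (prob_algebra M)"
begin

abbreviation "G \<equiv> limit_cdf M \<phi> s"

lemma sets_s [measurable_cong]: "sets (s n) = sets M"
  using s_prob[of n] by (simp add: space_prob_algebra)

lemma limit_cdf_le_1: "G x \<le> 1"
proof -
  have "emeasure (s n) A \<le> 1" for n A
    using s_prob[of n] by (auto simp: space_prob_algebra intro: prob_space.emeasure_le_1)
  then have "liminf (\<lambda>n. emeasure (s n) (sublevel M \<phi> (x + 1))) \<le> 1"
    by (intro Liminf_le) auto
  then show ?thesis
    unfolding limit_cdf_def by (intro INF_lower2[of 0]) auto
qed

lemma sublevel_liminf_mono:
  "x \<le> y \<Longrightarrow> liminf (\<lambda>n. emeasure (s n) (sublevel M \<phi> x)) \<le> liminf (\<lambda>n. emeasure (s n) (sublevel M \<phi> y))"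
  by (intro Liminf_mono always_eventually allI emeasure_mono) (auto simp: sublevel_def)

lemma limit_cdf_mono: "x \<le> y \<Longrightarrow> G x \<le> G y"
  unfolding limit_cdf_def by (intro INF_mono' sublevel_liminf_mono) simp

lemma ennreal_limit_cdf: "ennreal (enn2real (G x)) = G x"
  using limit_cdf_le_1[of x] by (intro ennreal_enn2real) (auto intro: le_less_trans)

lemma enn2real_limit_cdf_mono: "x \<le> y \<Longrightarrow> enn2real (G x) \<le> enn2real (G y)"
  using limit_cdf_mono[of x y] limit_cdf_le_1[of y]
  by (intro enn2real_mono) (auto intro: le_less_trans)

lemma limit_cdf_right_cont: "continuous (at_right a) (\<lambda>x. enn2real (G x))"
proof (subst continuous_at_right_real_increasing)
  show "\<forall>e>0. \<exists>d>0. enn2real (G (a + d)) - enn2real (G a) < e"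
  proof (intro allI impI)
    fix e :: real assume "e > 0"
    then have "ennreal (enn2real (G a)) < ennreal (enn2real (G a) + e)"
      by (simp add: ennreal_less_iff del: ennreal_plus)
    then have "G a < G a + ennreal e"
      using \<open>e > 0\<close> by (simp add: ennreal_limit_cdf)
    then obtain k where k: "liminf (\<lambda>n. emeasure (s n) (sublevel M \<phi> (a + 1 / Suc k))) < G a + ennreal e"
      unfolding limit_cdf_def INF_less_iff by auto
    \<comment> \<open>\<open>k\<close> comes from a term of the infimum close to \<open>G a\<close>.
      Half of its gap \<open>1 / Suc k\<close> is spent on \<open>d\<close>, and the term of index
      \<open>2 * Suc k\<close> in \<open>G (a + d)\<close> fits into the other half.\<close>
    define d where "d = 1 / (2 * real (Suc k))"
    have "d > 0" by (simp add: d_def)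
    have "G (a + d) \<le> liminf (\<lambda>n. emeasure (s n) (sublevel M \<phi> (a + d + 1 / Suc (2 * Suc k))))"
      unfolding limit_cdf_def by (rule INF_lower) simp
    also have "\<dots> \<le> liminf (\<lambda>n. emeasure (s n) (sublevel M \<phi> (a + 1 / Suc k)))"
    proof (rule sublevel_liminf_mono)
      have "1 / real (Suc (2 * Suc k)) \<le> d"
        unfolding d_def by (intro divide_left_mono) auto
      moreover have "d + d = 1 / Suc k"
        by (simp add: d_def field_simps)
      ultimately show "a + d + 1 / Suc (2 * Suc k) \<le> a + 1 / Suc k"
        by linarith
    qed
    finally have "G (a + d) < G a + ennreal e"
      using k by simp
    then have "ennreal (enn2real (G (a + d))) < ennreal (enn2real (G a) + e)"
      using \<open>e > 0\<close> by (simp add: ennreal_limit_cdf)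
    then have "enn2real (G (a + d)) < enn2real (G a) + e"
      by (simp add: ennreal_less_iff)
    then show "\<exists>d>0. enn2real (G (a + d)) - enn2real (G a) < e"
      using \<open>d > 0\<close> by (intro exI[of _ d]) simp
  qed
qed (rule enn2real_limit_cdf_mono)

lemma limit_cdf_bot: "((\<lambda>x. enn2real (G x)) \<longlongrightarrow> 0) at_bot"
proof (rule tendsto_eventually)
  \<comment> \<open>The threshold is -1 and not 0 because the term \<open>k = 0\<close> of the
    infimum looks one unit further to the right.\<close>
  have "G x = 0" if "x < - 1" for x
  proof -
    have "sublevel M \<phi> (x + 1) = {}"
      using \<phi>_range that by (force simp: sublevel_def)
    then have "liminf (\<lambda>n. emeasure (s n) (sublevel M \<phi> (x + 1 / Suc 0))) = 0"
      by (simp add: Liminf_const)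
    then have "G x \<le> 0"
      unfolding limit_cdf_def by (intro INF_lower2[of 0]) auto
    then show ?thesis by simp
  qed
  then show "\<forall>\<^sub>F x in at_bot. enn2real (G x) = 0"
    by (intro eventually_at_bot_linorderI[of "-2"]) simp
qed

lemma limit_cdf_top: "((\<lambda>x. enn2real (G x)) \<longlongrightarrow> 1) at_top"
proof (rule tendsto_eventually)
  have "G x = 1" if "1 \<le> x" for x
  proof -
    have "sublevel M \<phi> (x + 1 / Suc k) = space M" for k
      using \<phi>_range that by (force simp: sublevel_def intro: order_trans)
    moreover have "emeasure (s n) (space M) = 1" for n
      using s_prob[of n] sets_eq_imp_space_eq[OF sets_s[of n]]
      by (auto simp: space_prob_algebra dest: prob_space.emeasure_space_1)
    ultimately show ?thesis
      unfolding limit_cdf_def by (simp add: Liminf_const)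
  qed
  then show "\<forall>\<^sub>F x in at_top. enn2real (G x) = 1"
    by (intro eventually_at_top_linorderI[of 1]) simp
qed

lemma real_distribution_limit: "real_distribution (interval_measure (\<lambda>x. enn2real (G x)))"
  by (intro real_distribution_interval_measure enn2real_limit_cdf_mono limit_cdf_right_cont
      limit_cdf_bot limit_cdf_top)

lemma emeasure_limit_atMost:
  "emeasure (interval_measure (\<lambda>x. enn2real (G x))) {..x} = G x"
  by (subst emeasure_interval_measure_Iic[OF enn2real_limit_cdf_mono limit_cdf_right_cont limit_cdf_bot])
     (auto simp: ennreal_limit_cdf)

end

text \<open>Rays generate the Borel sets and are closed under intersection, so measurability need
  only be checked on their masses, which are infima of lower limits of measurable functions of
  \<open>y\<close>.\<close>

lemma measurable_interval_measure_limit_cdf: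
  assumes \<phi>[measurable]: "\<phi> \<in> borel_measurable M"
    and \<phi>_range: "\<And>\<omega>. \<omega> \<in> space M \<Longrightarrow> \<phi> \<omega> \<in> {0..1}"
    and g: "\<And>n. g n \<in> N \<rightarrow>\<^sub>M prob_algebra M"
  shows "(\<lambda>y. interval_measure (\<lambda>x. enn2real (limit_cdf M \<phi> (\<lambda>n. g n y) x))) \<in> N \<rightarrow>\<^sub>M prob_algebra borel"
proof (rule measurable_prob_algebra_generated[where G = "range atMost" and \<Omega> = UNIV])
  show "sets borel = sigma_sets UNIV (range atMost :: real set set)"
    by (subst borel_eq_atMost) (simp add: sets_measure_of)
  show "Int_stable (range atMost :: real set set)"
    by (auto simp: Int_stable_def)
  fix y assume "y \<in> space N"
  then interpret unit_sequence M \<phi> "\<lambda>n. g n y"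
    using \<phi> \<phi>_range g by unfold_locales (auto dest: measurable_space)
  show "prob_space (interval_measure (\<lambda>x. enn2real (limit_cdf M \<phi> (\<lambda>n. g n y) x)))"
    using real_distribution_limit by (simp add: real_distribution_def)
next
  fix A assume "A \<in> range (atMost :: real \<Rightarrow> real set)"
  then obtain x where A: "A = {..x}" by auto
  have [measurable]: "(\<lambda>y. emeasure (g n y) B) \<in> borel_measurable N" if "B \<in> sets M" for B n
    using that measurable_prob_algebraD[OF g]
    by (rule measurable_compose[OF _ measurable_emeasure_subprob_algebra, rotated])
  have "(\<lambda>y. limit_cdf M \<phi> (\<lambda>n. g n y) x) \<in> borel_measurable N"
    unfolding limit_cdf_def by measurable
  moreover have "emeasure (interval_measure (\<lambda>x. enn2real (limit_cdf M \<phi> (\<lambda>n. g n y) x))) A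
      = limit_cdf M \<phi> (\<lambda>n. g n y) x" if "y \<in> space N" for y
  proof -
    interpret unit_sequence M \<phi> "\<lambda>n. g n y"
      using \<phi> \<phi>_range g that by unfold_locales (auto dest: measurable_space)
    show ?thesis
      unfolding A by (rule emeasure_limit_atMost)
  qed
  ultimately show "(\<lambda>y. emeasure (interval_measure (\<lambda>x. enn2real (limit_cdf M \<phi> (\<lambda>n. g n y) x))) A)
      \<in> borel_measurable N"
    by (subst measurable_cong) auto
qed auto

lemma measurable_limit_measure:
  assumes "\<phi> \<in> borel_measurable M" "\<And>\<omega>. \<omega> \<in> space M \<Longrightarrow> \<phi> \<omega> \<in> {0..1}" "\<rho> \<in> borel \<rightarrow>\<^sub>M M"
    and "\<And>n. g n \<in> N \<rightarrow>\<^sub>M prob_algebra M"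
  shows "(\<lambda>y. limit_measure M \<phi> \<rho> (\<lambda>n. g n y)) \<in> N \<rightarrow>\<^sub>M prob_algebra M"
  unfolding limit_measure_def
  using measurable_interval_measure_limit_cdf[OF assms(1,2,4)] measurable_distr_prob_space[OF assms(3)]
  by (rule measurable_compose)

text \<open>The law of \<phi> is fixed by its values on rational rays, and \<rho> carries that law
  back to the measure. Countability of the test sets is what later turns almost sure statements for
  each \<open>q\<close> into identities of measures off one null set.\<close>

lemma measure_eqI_sublevel_rat:
  fixes \<phi> :: "'a \<Rightarrow> real"
  assumes \<phi>[measurable]: "\<phi> \<in> borel_measurable M" and \<rho>[measurable]: "\<rho> \<in> borel \<rightarrow>\<^sub>M M"
    and inv: "\<And>\<omega>. \<omega> \<in> space M \<Longrightarrow> \<rho> (\<phi> \<omega>) = \<omega>"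
    and \<mu>: "\<mu> \<in> space (prob_algebra M)" and \<nu>: "\<nu> \<in> space (prob_algebra M)"
    and eq: "\<And>q. emeasure \<mu> (sublevel M \<phi> (real_of_rat q)) = emeasure \<nu> (sublevel M \<phi> (real_of_rat q))"
  shows "\<mu> = \<nu>"
proof -
  let ?E = "range (\<lambda>q. {..real_of_rat q})"
  have borel: "borel = sigma UNIV ?E"
  proof (rule borel_eq_sigmaI1[OF borel_eq_atMost])
    fix X assume "X \<in> range (atMost :: real \<Rightarrow> real set)"
    then obtain x where X: "X = {..x}" by auto
    have "X = (\<Inter>q\<in>{q. x \<le> real_of_rat q}. {..real_of_rat q})"
    proof (intro equalityI subsetI)
      fix y assume y: "y \<in> (\<Inter>q\<in>{q. x \<le> real_of_rat q}. {..real_of_rat q})"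
      show "y \<in> X"
      proof (rule ccontr)
        assume "y \<notin> X"
        then obtain q where "x < real_of_rat q" "real_of_rat q < y"
          using of_rat_dense[of x y] X by auto
        moreover have "y \<le> real_of_rat q"
          using y \<open>x < real_of_rat q\<close> by (auto intro: less_imp_le)
        ultimately show False by simp
      qed
    qed (auto simp: X)
    also have "\<dots> \<in> sets (sigma UNIV ?E)"
      by (rule sets.countable_INT'') (auto intro: sigma_sets_top)
    finally show "X \<in> sets (sigma UNIV ?E)" .
  qed auto
  have sets: "sets \<mu> = sets M" "sets \<nu> = sets M"
    using \<mu> \<nu> by (auto simp: space_prob_algebra)
  note [measurable_cong] = sets
  note space = sets_eq_imp_space_eq[OF sets(1)] sets_eq_imp_space_eq[OF sets(2)]
  interpret \<mu>: prob_space \<mu> using \<mu> by (simp add: space_prob_algebra)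
  interpret d: prob_space "distr \<mu> borel \<phi>" by (rule \<mu>.prob_space_distr) measurable
  have distr: "distr \<mu> borel \<phi> = distr \<nu> borel \<phi>"
  proof (rule measure_eqI_generator_eq[where E = ?E and \<Omega> = UNIV
        and A = "\<lambda>i. {..real_of_rat (of_nat i)}"])
    show "Int_stable ?E"
    proof (rule Int_stableI)
      fix X Y assume "X \<in> ?E" "Y \<in> ?E"
      then obtain p q where "X = {..real_of_rat p}" "Y = {..real_of_rat q}" by auto
      then have "X \<inter> Y = {..real_of_rat (min p q)}"
        by (auto simp: min_def of_rat_less_eq)
      then show "X \<inter> Y \<in> ?E" by blast
    qed
    show "(\<Union>i. {..real_of_rat (of_nat i)}) = UNIV"
    proof (intro equalityI subsetI)
      fix x :: real
      obtain i :: nat where "x \<le> real i"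
        using real_arch_simple by blast
      then show "x \<in> (\<Union>i. {..real_of_rat (of_nat i)})"
        by (intro UN_I[of i]) auto
    qed simp
    fix X assume "X \<in> ?E"
    then obtain q where "X = {..real_of_rat q}" by auto
    then show "emeasure (distr \<mu> borel \<phi>) X = emeasure (distr \<nu> borel \<phi>) X"
      using eq[of q] space by (simp add: emeasure_distr sublevel_def vimage_def Int_def conj_commute)
  next
    have "sets borel = sigma_sets UNIV ?E"
      by (subst borel) simp
    then show "sets (distr \<mu> borel \<phi>) = sigma_sets UNIV ?E"
      "sets (distr \<nu> borel \<phi>) = sigma_sets UNIV ?E"
      by simp_all
    show "range (\<lambda>i. {..real_of_rat (of_nat i)}) \<subseteq> ?E"
      by blast
  qed (use d.emeasure_finite in auto)
  have "distr (distr \<mu>' borel \<phi>) M \<rho> = \<mu>'" if [measurable_cong]: "sets \<mu>' = sets M" for \<mu>'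
  proof -
    have "distr (distr \<mu>' borel \<phi>) M \<rho> = distr \<mu>' M (\<rho> \<circ> \<phi>)"
      by (rule distr_distr) measurable
    also have "\<dots> = distr \<mu>' \<mu>' (\<lambda>x. x)"
      using that sets_eq_imp_space_eq[OF that] by (intro distr_cong) (auto simp: inv)
    finally show ?thesis by simp
  qed
  then show ?thesis
    using distr sets by (metis (no_types))
qed

subsection \<open>Conditioning a Gibbs measure on the tail\<close>

text \<open>Conditioning on the tail sees only a decreasing sequence of sigma-algebras with proper
  kernels. Sites and finite windows return at the end.\<close>

locale tail_specification =
  fixes M :: "'a measure" and F :: "nat \<Rightarrow> 'a measure" and g :: "nat \<Rightarrow> 'a \<Rightarrow> 'a measure"
    and \<phi> :: "'a \<Rightarrow> real" and \<rho> :: "real \<Rightarrow> 'a"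
  assumes subalg: "\<And>n. subalgebra M (F n)"
    and decr: "\<And>m n. m \<le> n \<Longrightarrow> sets (F n) \<subseteq> sets (F m)"
    and kernel: "\<And>n. g n \<in> F n \<rightarrow>\<^sub>M prob_algebra M"
    and proper: "\<And>n A \<omega>. A \<in> sets (F n) \<Longrightarrow> \<omega> \<in> space M \<Longrightarrow> emeasure (g n \<omega>) A = indicator A \<omega>"
    and \<phi>_meas [measurable]: "\<phi> \<in> borel_measurable M"
    and \<rho>_meas [measurable]: "\<rho> \<in> borel \<rightarrow>\<^sub>M M"
    and \<phi>_range: "\<And>\<omega>. \<omega> \<in> space M \<Longrightarrow> \<phi> \<omega> \<in> {0..1}"
    and \<rho>_\<phi>: "\<And>\<omega>. \<omega> \<in> space M \<Longrightarrow> \<rho> (\<phi> \<omega>) = \<omega>"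
begin

definition T :: "'a measure" where
  "T = sigma (space M) (\<Inter>n. sets (F n))"

definition gibbs :: "'a measure set" where
  "gibbs = {\<mu> \<in> space (prob_algebra M).
     \<forall>n. \<forall>A\<in>sets M. (\<integral>\<^sup>+\<omega>. emeasure (g n \<omega>) A \<partial>\<mu>) = emeasure \<mu> A}"

definition \<pi> :: "'a \<Rightarrow> 'a measure" where
  "\<pi> \<omega> = limit_measure M \<phi> \<rho> (\<lambda>n. g n \<omega>)"

abbreviation A\<^sub>q :: "rat \<Rightarrow> 'a set" where
  "A\<^sub>q q \<equiv> sublevel M \<phi> (real_of_rat q)"

lemma space_F: "space (F n) = space M" and sets_F: "sets (F n) \<subseteq> sets M"
  using subalg[of n] by (auto simp: subalgebra_def)

lemma space_T: "space T = space M"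
  unfolding T_def using sets_F[of 0] sets.space_closed by (intro space_measure_of) blast

lemma sets_T: "sets T = (\<Inter>n. sets (F n))"
proof -
  have "sigma_sets (space M) (\<Inter>n. sets (F n)) \<subseteq> sets (F n)" for n
    using sets.sigma_sets_subset[of "\<Inter>n. sets (F n)" "F n"] by (auto simp: space_F)
  then have "sigma_sets (space M) (\<Inter>n. sets (F n)) = (\<Inter>n. sets (F n))"
    by (auto intro: sigma_sets.Basic)
  moreover have "(\<Inter>n. sets (F n)) \<subseteq> Pow (space M)"
    using sets_F[of 0] sets.space_closed by blast
  ultimately show ?thesis
    by (simp add: T_def)
qed

lemma subalg_T: "subalgebra M T"
  using sets_F[of 0] by (auto simp: subalgebra_def space_T sets_T)

lemma measurable_T:
  assumes "\<And>n. f \<in> F n \<rightarrow>\<^sub>M N"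
  shows "f \<in> T \<rightarrow>\<^sub>M N"
  using assms by (auto simp: measurable_def space_T sets_T space_F)

lemma kernel_M [measurable]: "g n \<in> M \<rightarrow>\<^sub>M prob_algebra M"
  using measurable_from_subalg[OF subalg kernel] .

lemma emeasure_kernel_F: "A \<in> sets M \<Longrightarrow> (\<lambda>\<omega>. emeasure (g n \<omega>) A) \<in> borel_measurable (F n)"
  using measurable_prob_algebraD[OF kernel] measurable_emeasure_subprob_algebra
  by (rule measurable_compose)

lemma emeasure_kernel_M [measurable]: "A \<in> sets M \<Longrightarrow> (\<lambda>\<omega>. emeasure (g n \<omega>) A) \<in> borel_measurable M"
  using measurable_from_subalg[OF subalg emeasure_kernel_F] .

lemma kernel_prob: "\<omega> \<in> space M \<Longrightarrow> g n \<omega> \<in> space (prob_algebra M)"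
  using measurable_space[OF kernel_M] .

lemma unit_sequence: "\<omega> \<in> space M \<Longrightarrow> unit_sequence M \<phi> (\<lambda>n. g n \<omega>)"
  using \<phi>_range by unfold_locales (auto intro: kernel_prob)

text \<open>Since \<open>L\<close> does not see the first \<open>m\<close> terms, it may be
  evaluated on the terms from \<open>m\<close> on, all of which are measurable with respect to
  \<open>F m\<close>; and \<open>m\<close> is arbitrary.\<close>

lemma measurable_limit_tail:
  assumes "\<And>m. (\<lambda>\<omega>. L (\<lambda>n. g (n + m) \<omega>)) \<in> F m \<rightarrow>\<^sub>M N"
    and shift: "\<And>s m. L (\<lambda>n. s (n + m)) = L s"
  shows "(\<lambda>\<omega>. L (\<lambda>n. g n \<omega>)) \<in> T \<rightarrow>\<^sub>M N"
proof (rule measurable_T)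
  fix m
  have "L (\<lambda>n. g (n + m) \<omega>) = L (\<lambda>n. g n \<omega>)" for \<omega>
    by (rule shift)
  then show "(\<lambda>\<omega>. L (\<lambda>n. g n \<omega>)) \<in> F m \<rightarrow>\<^sub>M N"
    using assms(1)[of m] by simp
qed

lemma kernel_F_shift: "m \<le> n \<Longrightarrow> g n \<in> F m \<rightarrow>\<^sub>M prob_algebra M"
  using measurable_from_subalg[OF _ kernel, of "F m" n] decr[of m n]
  by (auto simp: subalgebra_def space_F)

lemma \<pi>_T: "\<pi> \<in> T \<rightarrow>\<^sub>M prob_algebra M"
  unfolding \<pi>_def
proof (rule measurable_limit_tail)
  show "(\<lambda>\<omega>. limit_measure M \<phi> \<rho> (\<lambda>n. g (n + m) \<omega>)) \<in> F m \<rightarrow>\<^sub>M prob_algebra M" for m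
    by (intro measurable_limit_measure \<phi>_range kernel_F_shift) auto
qed (rule limit_measure_shift)

lemma \<pi>_M [measurable]: "\<pi> \<in> M \<rightarrow>\<^sub>M prob_algebra M"
  using measurable_from_subalg[OF subalg_T \<pi>_T] .

lemma \<pi>_prob: "\<omega> \<in> space M \<Longrightarrow> \<pi> \<omega> \<in> space (prob_algebra M)"
  using measurable_space[OF \<pi>_M] .

lemma emeasure_\<pi>_T: "A \<in> sets M \<Longrightarrow> (\<lambda>\<omega>. emeasure (\<pi> \<omega>) A) \<in> borel_measurable T"
  using measurable_prob_algebraD[OF \<pi>_T] measurable_emeasure_subprob_algebra
  by (rule measurable_compose)

lemma emeasure_\<pi>_M [measurable]: "A \<in> sets M \<Longrightarrow> (\<lambda>\<omega>. emeasure (\<pi> \<omega>) A) \<in> borel_measurable M"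
  using measurable_from_subalg[OF subalg_T emeasure_\<pi>_T] .

lemma nn_integral_\<pi>_M [measurable]:
  "h \<in> borel_measurable M \<Longrightarrow> (\<lambda>\<omega>. \<integral>\<^sup>+\<sigma>. h \<sigma> \<partial>\<pi> \<omega>) \<in> borel_measurable M"
  using measurable_prob_algebraD[OF \<pi>_M] nn_integral_measurable_subprob_algebra
  by (rule measurable_compose)

lemma nn_integral_\<pi>_T:
  "h \<in> borel_measurable M \<Longrightarrow> (\<lambda>\<omega>. \<integral>\<^sup>+\<sigma>. h \<sigma> \<partial>\<pi> \<omega>) \<in> borel_measurable T"
  using measurable_prob_algebraD[OF \<pi>_T] nn_integral_measurable_subprob_algebra
  by (rule measurable_compose)

lemma measure_eqI_A\<^sub>q:
  assumes "\<mu> \<in> space (prob_algebra M)" "\<nu> \<in> space (prob_algebra M)"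
    and "\<And>q. emeasure \<mu> (A\<^sub>q q) = emeasure \<nu> (A\<^sub>q q)"
  shows "\<mu> = \<nu>"
  by (rule measure_eqI_sublevel_rat[OF \<phi>_meas \<rho>_meas \<rho>_\<phi> assms])

text \<open>\<open>\<mu> \<bind> g n\<close> and \<mu> are both probability measures, so agreement
  on the countably many sets \<open>A\<^sub>q q\<close> makes them equal.\<close>

lemma gibbsI_A\<^sub>q:
  assumes \<mu>: "\<mu> \<in> space (prob_algebra M)"
    and eq: "\<And>n q. (\<integral>\<^sup>+\<omega>. emeasure (g n \<omega>) (A\<^sub>q q) \<partial>\<mu>) = emeasure \<mu> (A\<^sub>q q)"
  shows "\<mu> \<in> gibbs"
proof -
  have [measurable_cong]: "sets \<mu> = sets M" and "prob_space \<mu>"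
    using \<mu> by (auto simp: space_prob_algebra)
  then have ne: "space \<mu> \<noteq> {}"
    by (simp add: prob_space.not_empty)
  have g_\<mu>: "g n \<in> \<mu> \<rightarrow>\<^sub>M prob_algebra M" for n
    by measurable
  have bind: "emeasure (\<mu> \<bind> g n) A = (\<integral>\<^sup>+\<omega>. emeasure (g n \<omega>) A \<partial>\<mu>)" if "A \<in> sets M" for A n
    by (rule emeasure_bind[OF ne measurable_prob_algebraD[OF g_\<mu>] that])
  have "\<mu> \<bind> g n = \<mu>" for n
  proof (rule measure_eqI_A\<^sub>q)
    show "\<mu> \<bind> g n \<in> space (prob_algebra M)"
      using prob_space_bind'[OF \<mu> kernel_M] sets_bind[OF _ ne, of "g n" M] kernel_prob
      by (auto simp: space_prob_algebra sets_eq_imp_space_eq[OF \<open>sets \<mu> = sets M\<close>])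
  qed (auto simp: \<mu> bind eq)
  then show ?thesis
    using \<mu> bind by (auto simp: gibbs_def)
qed

end

section \<open>Limits and conditional expectations under a fixed Gibbs measure\<close>

locale tail_gibbs = tail_specification +
  fixes \<mu> :: "'a measure"
  assumes \<mu>: "\<mu> \<in> gibbs"
begin

lemma sets_\<mu> [measurable_cong, simp]: "sets \<mu> = sets M"
  using \<mu> by (simp add: gibbs_def space_prob_algebra)

lemma space_\<mu>: "space \<mu> = space M"
  by (rule sets_eq_imp_space_eq[OF sets_\<mu>])

sublocale prob_space \<mu>
  using \<mu> by (simp add: gibbs_def space_prob_algebra)

lemma subalg_\<mu>: "subalgebra M N \<Longrightarrow> subalgebra \<mu> N"
  by (simp add: subalgebra_def space_\<mu>)

sublocale T: finite_measure_subalgebra \<mu> T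
  by unfold_locales (rule subalg_\<mu>[OF subalg_T])

lemma gibbs_kernel: "A \<in> sets M \<Longrightarrow> (\<integral>\<^sup>+\<omega>. emeasure (g n \<omega>) A \<partial>\<mu>) = emeasure \<mu> A"
  using \<mu> by (simp add: gibbs_def)

text \<open>Properness is used here: \<open>B\<close> has mass 0 or 1 under
  \<open>g n \<omega>\<close>, according to \<omega>, and so can be moved into the kernel. In other
  words, \<open>g n\<close> is a conditional probability of \<mu> given \<open>F n\<close>.\<close>

lemma gibbs_conditional:
  assumes A [measurable]: "A \<in> sets M" and B: "B \<in> sets (F n)"
  shows "(\<integral>\<^sup>+\<omega>\<in>B. emeasure (g n \<omega>) A \<partial>\<mu>) = emeasure \<mu> (A \<inter> B)"
proof -
  have B_M [measurable]: "B \<in> sets M"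
    using B sets_F by blast
  have "emeasure (g n \<omega>) (A \<inter> B) = emeasure (g n \<omega>) A * indicator B \<omega>" if \<omega>: "\<omega> \<in> space \<mu>" for \<omega>
  proof -
    have \<omega>: "\<omega> \<in> space M"
      using \<omega> by (simp add: space_\<mu>)
    have sets: "sets (g n \<omega>) = sets M"
      using kernel_prob[OF \<omega>, of n] by (simp add: space_prob_algebra)
    have "space M - B \<in> sets (F n)"
      using B sets.compl_sets[OF B] by (simp add: space_F)
    then have compl: "emeasure (g n \<omega>) (space M - B) = indicator (space M - B) \<omega>"
      using \<omega> by (rule proper)
    show ?thesis
    proof (cases "\<omega> \<in> B")
      case True
      have "emeasure (g n \<omega>) (A \<inter> B) = emeasure (g n \<omega>) A"
      proof (rule emeasure_eq_AE)
        have "space M - B \<in> null_sets (g n \<omega>)"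
          using compl True by (intro null_setsI) (auto simp: sets)
        then have "AE \<sigma> in g n \<omega>. \<sigma> \<notin> space M - B"
          by (rule AE_not_in)
        with AE_space show "AE \<sigma> in g n \<omega>. \<sigma> \<in> A \<inter> B \<longleftrightarrow> \<sigma> \<in> A"
          by eventually_elim (auto simp: sets_eq_imp_space_eq[OF sets])
      qed (auto simp: sets)
      then show ?thesis using True by simp
    next
      case False
      have "emeasure (g n \<omega>) (A \<inter> B) \<le> emeasure (g n \<omega>) B"
        by (rule emeasure_mono) (auto simp: sets)
      then show ?thesis
        using proper[OF B \<omega>] False by simp
    qed
  qed
  then have "(\<integral>\<^sup>+\<omega>\<in>B. emeasure (g n \<omega>) A \<partial>\<mu>) = (\<integral>\<^sup>+\<omega>. emeasure (g n \<omega>) (A \<inter> B) \<partial>\<mu>)"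
    by (intro nn_integral_cong) simp
  then show ?thesis
    by (simp add: gibbs_kernel)
qed

lemma emeasure_kernel_eq_measure:
  assumes "\<omega> \<in> space M"
  shows "emeasure (g n \<omega>) A = ennreal (measure (g n \<omega>) A)" "measure (g n \<omega>) A \<le> 1"
proof -
  interpret K: prob_space "g n \<omega>"
    using kernel_prob[OF assms] by (simp add: space_prob_algebra)
  show "emeasure (g n \<omega>) A = ennreal (measure (g n \<omega>) A)" "measure (g n \<omega>) A \<le> 1"
    by (auto simp: K.emeasure_eq_measure)
qed

lemma AE_convergent_kernel:
  assumes A [measurable]: "A \<in> sets M"
  shows "AE \<omega> in \<mu>. convergent (\<lambda>n. measure (g n \<omega>) A)"
proof (rule reverse_martingale_AE_convergent[where F = F and f = "indicator A"])
  show X: "(\<lambda>\<omega>. measure (g n \<omega>) A) \<in> borel_measurable (F n)" for n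
    unfolding measure_def using emeasure_kernel_F[OF A] by measurable
  then have [measurable]: "(\<lambda>\<omega>. measure (g n \<omega>) A) \<in> borel_measurable M" for n
    using measurable_from_subalg[OF subalg] by blast
  show "\<bar>measure (g n \<omega>) A\<bar> \<le> 1" if "\<omega> \<in> space \<mu>" for n \<omega>
    using emeasure_kernel_eq_measure(2) that by (simp add: space_\<mu>)
  show "(\<integral>\<omega>\<in>B. measure (g n \<omega>) A \<partial>\<mu>) = (\<integral>\<omega>\<in>B. indicator A \<omega> \<partial>\<mu>)" if B: "B \<in> sets (F n)" for n B
  proof -
    have [measurable]: "B \<in> sets M"
      using B sets_F by blast
    have "(\<integral>\<omega>\<in>B. measure (g n \<omega>) A \<partial>\<mu>) = enn2real (\<integral>\<^sup>+\<omega>. ennreal (indicator B \<omega> * measure (g n \<omega>) A) \<partial>\<mu>)"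
      unfolding set_lebesgue_integral_def by (subst integral_eq_nn_integral) auto
    also have "(\<integral>\<^sup>+\<omega>. ennreal (indicator B \<omega> * measure (g n \<omega>) A) \<partial>\<mu>) = (\<integral>\<^sup>+\<omega>\<in>B. emeasure (g n \<omega>) A \<partial>\<mu>)"
      by (intro nn_integral_cong)
         (auto simp: space_\<mu> emeasure_kernel_eq_measure(1) indicator_def)
    also have "enn2real \<dots> = measure \<mu> (A \<inter> B)"
      using gibbs_conditional[OF A B] by (simp add: measure_def)
    also have "\<dots> = (\<integral>\<omega>\<in>B. indicator A \<omega> \<partial>\<mu>)"
      unfolding set_lebesgue_integral_def by (simp add: indicator_inter_arith[symmetric] Int_commute)
    finally show ?thesis .
  qed
qed (use subalg_\<mu>[OF subalg] decr in \<open>auto simp: emeasure_eq_measure\<close>)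

text \<open>A tail event \<open>B\<close> lies in every \<open>F n\<close>, so the integrals over
  \<open>B\<close> are the same number for all \<open>n\<close>; almost sure convergence and the
  bound 1 let the limit pass inside.\<close>

lemma liminf_kernel:
  assumes A [measurable]: "A \<in> sets M" and B: "B \<in> sets T"
  shows "(\<integral>\<^sup>+\<omega>\<in>B. liminf (\<lambda>n. emeasure (g n \<omega>) A) \<partial>\<mu>) = emeasure \<mu> (A \<inter> B)"
proof -
  have [measurable]: "B \<in> sets M"
    using B subalg_T by (auto simp: subalgebra_def)
  have "(\<lambda>n. \<integral>\<^sup>+\<omega>\<in>B. emeasure (g n \<omega>) A \<partial>\<mu>) \<longlonglongrightarrow> (\<integral>\<^sup>+\<omega>\<in>B. liminf (\<lambda>n. emeasure (g n \<omega>) A) \<partial>\<mu>)"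
  proof (rule nn_integral_dominated_convergence[where w = "\<lambda>_. 1"])
    show "AE \<omega> in \<mu>. emeasure (g n \<omega>) A * indicator B \<omega> \<le> 1" for n
      using emeasure_kernel_eq_measure
      by (intro AE_I2) (auto simp: space_\<mu> indicator_def)
    show "AE \<omega> in \<mu>. (\<lambda>n. emeasure (g n \<omega>) A * indicator B \<omega>) \<longlonglongrightarrow>
        liminf (\<lambda>n. emeasure (g n \<omega>) A) * indicator B \<omega>"
      using AE_convergent_kernel[OF A] AE_space
    proof eventually_elim
      case (elim \<omega>)
      then obtain l where "(\<lambda>n. measure (g n \<omega>) A) \<longlonglongrightarrow> l"
        by (auto simp: convergent_def)
      then have "(\<lambda>n. emeasure (g n \<omega>) A) \<longlonglongrightarrow> ennreal l"
        using elim(2) by (simp add: emeasure_kernel_eq_measure(1) space_\<mu> tendsto_ennrealI)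
      moreover from this have "liminf (\<lambda>n. emeasure (g n \<omega>) A) = ennreal l"
        by (intro lim_imp_Liminf) auto
      ultimately show ?case
        by (cases "\<omega> \<in> B") auto
    qed
  qed (auto simp: emeasure_space_1)
  moreover have "(\<integral>\<^sup>+\<omega>\<in>B. emeasure (g n \<omega>) A \<partial>\<mu>) = emeasure \<mu> (A \<inter> B)" for n
    using B by (intro gibbs_conditional) (auto simp: sets_T)
  ultimately show ?thesis
    by (simp add: LIMSEQ_const_iff)
qed

text \<open>The infimum over \<open>k\<close> in \<open>limit_cdf\<close> costs nothing: it matches
  the continuity of \<mu> from above along the sublevel sets shrinking to level
  \<open>x\<close>.\<close>

lemma limit_cdf_kernel:
  assumes B: "B \<in> sets T"
  shows "(\<integral>\<^sup>+\<omega>\<in>B. limit_cdf M \<phi> (\<lambda>n. g n \<omega>) x \<partial>\<mu>) = emeasure \<mu> (sublevel M \<phi> x \<inter> B)"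
proof -
  have [measurable]: "B \<in> sets M"
    using B subalg_T by (auto simp: subalgebra_def)
  let ?x = "\<lambda>k. x + 1 / Suc k"
  let ?f = "\<lambda>k \<omega>. liminf (\<lambda>n. emeasure (g n \<omega>) (sublevel M \<phi> (?x k)))"
  have x_decr: "?x l \<le> ?x k" if "k \<le> l" for k l :: nat
    using that by (simp add: frac_le)
  have "(\<integral>\<^sup>+\<omega>\<in>B. limit_cdf M \<phi> (\<lambda>n. g n \<omega>) x \<partial>\<mu>) = (\<integral>\<^sup>+\<omega>. (INF k. ?f k \<omega> * indicator B \<omega>) \<partial>\<mu>)"
    by (intro nn_integral_cong) (auto simp: limit_cdf_def indicator_def)
  also have "\<dots> = (INF k. \<integral>\<^sup>+\<omega>\<in>B. ?f k \<omega> \<partial>\<mu>)"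
  proof (rule nn_integral_monotone_convergence_INF_AE)
    show "AE \<omega> in \<mu>. ?f (Suc k) \<omega> * indicator B \<omega> \<le> ?f k \<omega> * indicator B \<omega>" for k
    proof (rule AE_I2)
      fix \<omega> assume "\<omega> \<in> space \<mu>"
      then interpret unit_sequence M \<phi> "\<lambda>n. g n \<omega>"
        by (intro unit_sequence) (simp add: space_\<mu>)
      show "?f (Suc k) \<omega> * indicator B \<omega> \<le> ?f k \<omega> * indicator B \<omega>"
        by (intro mult_right_mono sublevel_liminf_mono x_decr) auto
    qed
    show "(\<integral>\<^sup>+\<omega>\<in>B. ?f 0 \<omega> \<partial>\<mu>) < \<infinity>"
      using B by (subst liminf_kernel) (auto simp: less_top[symmetric])
  qed measurable
  also have "\<dots> = (INF k. emeasure \<mu> (sublevel M \<phi> (?x k) \<inter> B))"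
    using B by (subst liminf_kernel) auto
  also have "\<dots> = emeasure \<mu> (\<Inter>k. sublevel M \<phi> (?x k) \<inter> B)"
  proof (rule INF_emeasure_decseq)
    show "decseq (\<lambda>k. sublevel M \<phi> (?x k) \<inter> B)"
      unfolding decseq_def sublevel_def using x_decr by (fastforce intro: order_trans)
  qed auto
  also have "(\<Inter>k. sublevel M \<phi> (?x k) \<inter> B) = sublevel M \<phi> x \<inter> B"
  proof -
    have "(\<forall>k. \<phi> \<omega> \<le> ?x k) \<longleftrightarrow> \<phi> \<omega> \<le> x" for \<omega>
    proof
      assume le: "\<forall>k. \<phi> \<omega> \<le> ?x k"
      show "\<phi> \<omega> \<le> x"
      proof (rule field_le_epsilon)
        fix e :: real assume "e > 0"
        then obtain k where "1 / Suc k < e"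
          using nat_approx_posE by blast
        then show "\<phi> \<omega> \<le> x + e"
          using le[rule_format, of k] by linarith
      qed
    qed (auto intro: add_increasing2)
    then show ?thesis
      by (auto simp: sublevel_def)
  qed
  finally show ?thesis .
qed

text \<open>On rays this is \<open>limit_cdf_kernel\<close>. Putting the restriction to
  \<open>B\<close> into a density turns both sides into finite measures on the line, which agree
  once they agree on rays; \<rho> then takes the identity back to \<open>M\<close>.\<close>

lemma \<pi>_conditional:
  assumes A [measurable]: "A \<in> sets M" and B: "B \<in> sets T"
  shows "(\<integral>\<^sup>+\<omega>\<in>B. emeasure (\<pi> \<omega>) A \<partial>\<mu>) = emeasure \<mu> (A \<inter> B)"
proof -
  have [measurable]: "B \<in> sets M"
    using B subalg_T by (auto simp: subalgebra_def)
  let ?\<mu>\<^sub>B = "density \<mu> (indicator B)"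
  define \<nu> where "\<nu> \<omega> = interval_measure (\<lambda>x. enn2real (limit_cdf M \<phi> (\<lambda>n. g n \<omega>) x))" for \<omega>
  have ne: "space ?\<mu>\<^sub>B \<noteq> {}"
    by (simp add: not_empty)
  have \<nu>_M: "\<nu> \<in> M \<rightarrow>\<^sub>M prob_algebra borel"
    unfolding \<nu>_def using \<phi>_range by (intro measurable_interval_measure_limit_cdf) auto
  have \<nu>_sub [measurable]: "\<nu> \<in> M \<rightarrow>\<^sub>M subprob_algebra borel"
    by (rule measurable_prob_algebraD[OF \<nu>_M])
  have [measurable]: "(\<lambda>\<omega>. emeasure (\<nu> \<omega>) C) \<in> borel_measurable M" if "C \<in> sets borel" for C
    using \<nu>_sub measurable_emeasure_subprob_algebra[OF that] by (rule measurable_compose)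
  have bind: "emeasure (?\<mu>\<^sub>B \<bind> \<nu>) C = (\<integral>\<^sup>+\<omega>\<in>B. emeasure (\<nu> \<omega>) C \<partial>\<mu>)" if "C \<in> sets borel" for C
  proof -
    have "emeasure (?\<mu>\<^sub>B \<bind> \<nu>) C = (\<integral>\<^sup>+\<omega>. emeasure (\<nu> \<omega>) C \<partial>?\<mu>\<^sub>B)"
      by (rule emeasure_bind[OF ne _ that]) measurable
    also have "\<dots> = (\<integral>\<^sup>+\<omega>\<in>B. emeasure (\<nu> \<omega>) C \<partial>\<mu>)"
      using that by (subst nn_integral_density) (auto simp: mult.commute)
    finally show ?thesis .
  qed
  have emeasure_B: "emeasure (distr ?\<mu>\<^sub>B borel \<phi>) C = emeasure \<mu> (\<phi> -` C \<inter> space M \<inter> B)"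
    if C [measurable]: "C \<in> sets borel" for C
    by (simp add: emeasure_distr space_\<mu> emeasure_density nn_integral_indicator'
        flip: indicator_inter_arith) (simp add: Int_commute)
  have "distr ?\<mu>\<^sub>B borel \<phi> = ?\<mu>\<^sub>B \<bind> \<nu>"
  proof (rule measure_eqI_generator_eq[where E = "range atMost" and \<Omega> = UNIV and A = "\<lambda>i. {..real i}"])
    have "sets (?\<mu>\<^sub>B \<bind> \<nu>) = sets borel"
      by (rule sets_bind[OF _ ne]) (simp add: \<nu>_def)
    then show "sets (?\<mu>\<^sub>B \<bind> \<nu>) = sigma_sets UNIV (range atMost)"
      by (simp add: borel_eq_atMost)
    show "sets (distr ?\<mu>\<^sub>B borel \<phi>) = sigma_sets UNIV (range atMost)"
      by (simp add: borel_eq_atMost)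
    show "emeasure (distr ?\<mu>\<^sub>B borel \<phi>) C = emeasure (?\<mu>\<^sub>B \<bind> \<nu>) C" if C_range: "C \<in> range atMost" for C
    proof -
      obtain x where C: "C = {..x}"
        using C_range by auto
      have "emeasure (?\<mu>\<^sub>B \<bind> \<nu>) C = (\<integral>\<^sup>+\<omega>\<in>B. limit_cdf M \<phi> (\<lambda>n. g n \<omega>) x \<partial>\<mu>)"
        unfolding bind[of C, unfolded C, simplified] C \<nu>_def
        by (intro nn_integral_cong)
           (simp add: unit_sequence.emeasure_limit_atMost[OF unit_sequence] space_\<mu>)
      also have "\<dots> = emeasure \<mu> (sublevel M \<phi> x \<inter> B)"
        using B by (rule limit_cdf_kernel)
      also have "sublevel M \<phi> x = \<phi> -` C \<inter> space M"
        by (auto simp: C sublevel_def)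
      also have "emeasure \<mu> (\<phi> -` C \<inter> space M \<inter> B) = emeasure (distr ?\<mu>\<^sub>B borel \<phi>) C"
        by (rule emeasure_B[symmetric]) (simp add: C)
      finally show ?thesis by simp
    qed
    show "emeasure (distr ?\<mu>\<^sub>B borel \<phi>) {..real i} \<noteq> \<infinity>" for i
      by (simp add: emeasure_B)
  qed (auto simp: Int_stable_def intro: real_arch_simple)
  then have "(\<integral>\<^sup>+\<omega>\<in>B. emeasure (\<nu> \<omega>) (\<rho> -` A) \<partial>\<mu>) = emeasure \<mu> (\<phi> -` (\<rho> -` A) \<inter> space M \<inter> B)"
    using bind[of "\<rho> -` A"] emeasure_B[of "\<rho> -` A"] measurable_sets[OF \<rho>_meas A] by simp
  also have "\<phi> -` (\<rho> -` A) \<inter> space M = A"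
    using sets.sets_into_space[OF A] by (auto simp: \<rho>_\<phi>)
  finally show ?thesis
    using measurable_sets[OF \<rho>_meas A]
    by (simp add: \<pi>_def limit_measure_def \<nu>_def emeasure_distr)
qed

lemma nn_integral_\<pi>_conditional:
  assumes h: "h \<in> borel_measurable M" and B: "B \<in> sets T"
  shows "(\<integral>\<^sup>+\<omega>\<in>B. (\<integral>\<^sup>+\<sigma>. h \<sigma> \<partial>\<pi> \<omega>) \<partial>\<mu>) = (\<integral>\<^sup>+\<omega>\<in>B. h \<omega> \<partial>\<mu>)"
proof -
  have [measurable]: "B \<in> sets M"
    using B subalg_T by (auto simp: subalgebra_def)
  note [measurable] = h
  let ?\<mu>\<^sub>B = "density \<mu> (indicator B)"
  have ne: "space ?\<mu>\<^sub>B \<noteq> {}"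
    by (simp add: not_empty)
  have \<pi>_sub: "\<pi> \<in> ?\<mu>\<^sub>B \<rightarrow>\<^sub>M subprob_algebra M"
    using measurable_prob_algebraD[OF \<pi>_M] by measurable
  have "?\<mu>\<^sub>B \<bind> \<pi> = ?\<mu>\<^sub>B"
  proof (rule measure_eqI)
    show sets: "sets (?\<mu>\<^sub>B \<bind> \<pi>) = sets ?\<mu>\<^sub>B"
      using \<pi>_prob by (subst sets_bind[OF _ ne]) (auto simp: space_\<mu> space_prob_algebra)
    fix A assume "A \<in> sets (?\<mu>\<^sub>B \<bind> \<pi>)"
    then have [measurable]: "A \<in> sets M"
      unfolding sets by simp
    have "emeasure (?\<mu>\<^sub>B \<bind> \<pi>) A = (\<integral>\<^sup>+\<omega>. emeasure (\<pi> \<omega>) A \<partial>?\<mu>\<^sub>B)"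
      by (rule emeasure_bind[OF ne \<pi>_sub]) measurable
    also have "\<dots> = (\<integral>\<^sup>+\<omega>\<in>B. emeasure (\<pi> \<omega>) A \<partial>\<mu>)"
      by (subst nn_integral_density) (auto simp: mult.commute)
    also have "\<dots> = emeasure \<mu> (A \<inter> B)"
      using B by (intro \<pi>_conditional) auto
    also have "\<dots> = emeasure ?\<mu>\<^sub>B A"
      by (simp add: emeasure_density Int_commute flip: indicator_inter_arith)
    finally show "emeasure (?\<mu>\<^sub>B \<bind> \<pi>) A = emeasure ?\<mu>\<^sub>B A" .
  qed
  then have "(\<integral>\<^sup>+\<omega>. (\<integral>\<^sup>+\<sigma>. h \<sigma> \<partial>\<pi> \<omega>) \<partial>?\<mu>\<^sub>B) = (\<integral>\<^sup>+\<omega>. h \<omega> \<partial>?\<mu>\<^sub>B)"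
    using nn_integral_bind[OF h \<pi>_sub] by simp
  then show ?thesis
    by (simp add: nn_integral_density mult.commute)
qed

lemma AE_nn_integral_\<pi>:
  assumes "h \<in> borel_measurable M"
  shows "AE \<omega> in \<mu>. (\<integral>\<^sup>+\<sigma>. h \<sigma> \<partial>\<pi> \<omega>) = nn_cond_exp \<mu> T h \<omega>"
  using assms
  by (intro T.nn_cond_exp_charact nn_integral_\<pi>_conditional[symmetric] nn_integral_\<pi>_T) auto

text \<open>A tail measurable \<open>h\<close> is its own conditional expectation given the tail.
  Taken for a bounded function and for its square, this says that the variance under almost every
  \<open>\<pi> \<omega>\<close> vanishes.\<close>

lemma AE_nn_integral_\<pi>_tail:
  assumes "h \<in> borel_measurable T"
  shows "AE \<omega> in \<mu>. (\<integral>\<^sup>+\<sigma>. h \<sigma> \<partial>\<pi> \<omega>) = h \<omega>"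
  using T.nn_cond_exp_F_meas[OF assms] AE_nn_integral_\<pi>[OF measurable_from_subalg[OF subalg_T assms]]
  by eventually_elim simp

text \<open>This is the tower property: as \<open>T\<close> is contained in \<open>F n\<close>, both
  \<pi>(A|.) and the average of the \<open>n\<close>-th kernel under \<pi> are versions of the
  conditional probability of \<open>A\<close> given the tail. Rational levels leave a single null
  set.\<close>

lemma AE_\<pi>_gibbs: "AE \<omega> in \<mu>. \<pi> \<omega> \<in> gibbs"
proof -
  have "AE \<omega> in \<mu>. (\<integral>\<^sup>+\<sigma>. emeasure (g n \<sigma>) (A\<^sub>q q) \<partial>\<pi> \<omega>) = emeasure (\<pi> \<omega>) (A\<^sub>q q)" for n q
  proof -
    have "AE \<omega> in \<mu>. emeasure (\<pi> \<omega>) (A\<^sub>q q) = nn_cond_exp \<mu> T (\<lambda>\<sigma>. emeasure (g n \<sigma>) (A\<^sub>q q)) \<omega>"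
    proof (rule T.nn_cond_exp_charact)
      fix B assume B: "B \<in> sets T"
      then have "(\<integral>\<^sup>+\<sigma>\<in>B. emeasure (g n \<sigma>) (A\<^sub>q q) \<partial>\<mu>) = emeasure \<mu> (A\<^sub>q q \<inter> B)"
        by (intro gibbs_conditional) (auto simp: sets_T)
      then show "(\<integral>\<^sup>+\<sigma>\<in>B. emeasure (g n \<sigma>) (A\<^sub>q q) \<partial>\<mu>) = (\<integral>\<^sup>+\<omega>\<in>B. emeasure (\<pi> \<omega>) (A\<^sub>q q) \<partial>\<mu>)"
        using B by (simp add: \<pi>_conditional)
    qed (auto intro: emeasure_\<pi>_T)
    moreover have "AE \<omega> in \<mu>. (\<integral>\<^sup>+\<sigma>. emeasure (g n \<sigma>) (A\<^sub>q q) \<partial>\<pi> \<omega>) =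
        nn_cond_exp \<mu> T (\<lambda>\<sigma>. emeasure (g n \<sigma>) (A\<^sub>q q)) \<omega>"
      by (rule AE_nn_integral_\<pi>) measurable
    ultimately show ?thesis
      by eventually_elim simp
  qed
  then have "AE \<omega> in \<mu>. \<forall>n q. (\<integral>\<^sup>+\<sigma>. emeasure (g n \<sigma>) (A\<^sub>q q) \<partial>\<pi> \<omega>) = emeasure (\<pi> \<omega>) (A\<^sub>q q)"
    by (simp add: AE_all_countable)
  with AE_space show ?thesis
    by eventually_elim (auto intro: gibbsI_A\<^sub>q \<pi>_prob simp: space_\<mu>)
qed

end

section \<open>Extreme Gibbs measures and tail triviality\<close>

context tail_specification
begin

text \<open>
  Under a Gibbs measure \<open>\<nu>\<close>, the random variable \<open>\<pi>(A|\<cdot>)\<close> has mean \<open>\<nu>(A)\<close>; the condition on second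
  moments says that its variance vanishes. Being a countable family of equations between
  measurable functions of \<open>\<nu>\<close>, it makes the set of extreme Gibbs measures measurable.
\<close>

definition trivial_gibbs :: "'a measure set" where
  "trivial_gibbs = {\<nu> \<in> gibbs.
     \<forall>q. (\<integral>\<^sup>+\<sigma>. (emeasure (\<pi> \<sigma>) (A\<^sub>q q))\<^sup>2 \<partial>\<nu>) = (emeasure \<nu> (A\<^sub>q q))\<^sup>2}"

lemma tail_gibbsI: "\<mu> \<in> gibbs \<Longrightarrow> tail_gibbs M F g \<phi> \<rho> \<mu>"
  by unfold_locales

lemma emeasure_\<pi>_eq_measure:
  assumes "\<omega> \<in> space M"
  shows "emeasure (\<pi> \<omega>) A = ennreal (measure (\<pi> \<omega>) A)" "measure (\<pi> \<omega>) A \<le> 1"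
proof -
  interpret K: prob_space "\<pi> \<omega>"
    using \<pi>_prob[OF assms] by (simp add: space_prob_algebra)
  show "emeasure (\<pi> \<omega>) A = ennreal (measure (\<pi> \<omega>) A)" "measure (\<pi> \<omega>) A \<le> 1"
    by (auto simp: K.emeasure_eq_measure)
qed

lemma trivial_gibbs_AE_const:
  assumes \<nu>: "\<nu> \<in> trivial_gibbs"
  shows "AE \<sigma> in \<nu>. emeasure (\<pi> \<sigma>) (A\<^sub>q q) = emeasure \<nu> (A\<^sub>q q)"
proof -
  interpret tail_gibbs M F g \<phi> \<rho> \<nu>
    using \<nu> by (intro tail_gibbsI) (simp add: trivial_gibbs_def)
  let ?Y = "\<lambda>\<sigma>. measure (\<pi> \<sigma>) (A\<^sub>q q)" and ?c = "prob (A\<^sub>q q)"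
  have [measurable]: "?Y \<in> borel_measurable M"
    unfolding measure_def by measurable
  have Y: "\<bar>?Y \<sigma>\<bar> \<le> 1" if "\<sigma> \<in> space M" for \<sigma>
    using emeasure_\<pi>_eq_measure(2)[OF that] by simp
  have int: "integrable \<nu> ?Y" "integrable \<nu> (\<lambda>\<sigma>. (?Y \<sigma>)\<^sup>2)"
    using Y by (auto intro!: integrable_const_bound[where B = 1] AE_I2 simp: space_\<mu> power_le_one)
  have "(\<integral>\<sigma>. ?Y \<sigma> \<partial>\<nu>) = enn2real (\<integral>\<^sup>+\<sigma>\<in>space M. emeasure (\<pi> \<sigma>) (A\<^sub>q q) \<partial>\<nu>)"
    by (subst integral_eq_nn_integral)
       (auto intro!: arg_cong[where f = enn2real] nn_integral_cong simp: space_\<mu> emeasure_\<pi>_eq_measure(1))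
  also have "(\<integral>\<^sup>+\<sigma>\<in>space M. emeasure (\<pi> \<sigma>) (A\<^sub>q q) \<partial>\<nu>) = emeasure \<nu> (A\<^sub>q q \<inter> space M)"
    by (rule \<pi>_conditional) (auto simp flip: space_T)
  also have "A\<^sub>q q \<inter> space M = A\<^sub>q q"
    by (auto simp: sublevel_def)
  finally have Y1: "(\<integral>\<sigma>. ?Y \<sigma> \<partial>\<nu>) = ?c"
    by (simp add: measure_def)
  have "(\<integral>\<sigma>. (?Y \<sigma>)\<^sup>2 \<partial>\<nu>) = enn2real (\<integral>\<^sup>+\<sigma>. (emeasure (\<pi> \<sigma>) (A\<^sub>q q))\<^sup>2 \<partial>\<nu>)"
    by (subst integral_eq_nn_integral)
       (auto intro!: arg_cong[where f = enn2real] nn_integral_cong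
         simp: space_\<mu> emeasure_\<pi>_eq_measure(1) ennreal_power)
  also have "\<dots> = ?c\<^sup>2"
    using \<nu> by (simp add: trivial_gibbs_def emeasure_eq_measure ennreal_power)
  finally have Y2: "(\<integral>\<sigma>. (?Y \<sigma>)\<^sup>2 \<partial>\<nu>) = ?c\<^sup>2" .
  have "(\<integral>\<sigma>. (?Y \<sigma> - ?c)\<^sup>2 \<partial>\<nu>) = (\<integral>\<sigma>. (?Y \<sigma>)\<^sup>2 - 2 * ?c * ?Y \<sigma> + ?c\<^sup>2 \<partial>\<nu>)"
    by (rule Bochner_Integration.integral_cong) (auto simp: power2_eq_square algebra_simps)
  also have "\<dots> = 0"
    using int by (simp add: Y1 Y2 prob_space) (simp add: power2_eq_square)
  finally have "(\<integral>\<sigma>. (?Y \<sigma> - ?c)\<^sup>2 \<partial>\<nu>) = 0" .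
  moreover have "integrable \<nu> (\<lambda>\<sigma>. (?Y \<sigma> - ?c)\<^sup>2)"
    using int by (auto simp: power2_diff)
  ultimately have "AE \<sigma> in \<nu>. (?Y \<sigma> - ?c)\<^sup>2 = 0"
    by (subst (asm) integral_nonneg_eq_0_iff_AE) auto
  with AE_space show ?thesis
    by eventually_elim (simp add: space_\<mu> emeasure_\<pi>_eq_measure(1) emeasure_eq_measure)
qed

text \<open>One kernel \<pi> serves every Gibbs measure. Under \<nu> the function \<pi>(A|.) is the
  constant \<nu>(A); absolute continuity carries this over to \<open>\<nu>'\<close>, where the
  integral of \<pi>(A|.) is the mass of \<open>A\<close> under \<open>\<nu>'\<close>.\<close>

lemma trivial_gibbs_dominates:
  assumes \<nu>: "\<nu> \<in> trivial_gibbs" and \<nu>': "\<nu>' \<in> gibbs"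
    and ac: "\<And>A. A \<in> sets M \<Longrightarrow> measure \<nu> A = 0 \<Longrightarrow> measure \<nu>' A = 0"
  shows "\<nu>' = \<nu>"
proof -
  interpret \<nu>: tail_gibbs M F g \<phi> \<rho> \<nu>
    using \<nu> by (intro tail_gibbsI) (simp add: trivial_gibbs_def)
  interpret \<nu>': tail_gibbs M F g \<phi> \<rho> \<nu>'
    using \<nu>' by (rule tail_gibbsI)
  show ?thesis
  proof (rule measure_eqI_A\<^sub>q)
    show "\<nu>' \<in> space (prob_algebra M)" "\<nu> \<in> space (prob_algebra M)"
      using \<nu>'.\<mu> \<nu>.\<mu> by (auto simp: gibbs_def)
    fix q
    have ac: "absolutely_continuous \<nu> \<nu>'"
      using ac by (auto simp: absolutely_continuous_def null_sets_def \<nu>.emeasure_eq_measure \<nu>'.emeasure_eq_measure)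
    have "AE \<sigma> in \<nu>'. emeasure (\<pi> \<sigma>) (A\<^sub>q q) = emeasure \<nu> (A\<^sub>q q)"
      by (rule absolutely_continuous_AE[OF _ ac trivial_gibbs_AE_const[OF \<nu>]]) simp
    then have "(\<integral>\<^sup>+\<sigma>\<in>space M. emeasure (\<pi> \<sigma>) (A\<^sub>q q) \<partial>\<nu>') = (\<integral>\<^sup>+\<sigma>\<in>space M. emeasure \<nu> (A\<^sub>q q) \<partial>\<nu>')"
      by (intro nn_integral_cong_AE) auto
    also have "\<dots> = emeasure \<nu> (A\<^sub>q q)"
      using \<nu>'.emeasure_space_1 by (simp add: nn_integral_cmult_indicator \<nu>'.space_\<mu>)
    finally have "emeasure \<nu> (A\<^sub>q q) = (\<integral>\<^sup>+\<sigma>\<in>space M. emeasure (\<pi> \<sigma>) (A\<^sub>q q) \<partial>\<nu>')" ..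
    also have "\<dots> = emeasure \<nu>' (A\<^sub>q q \<inter> space M)"
      by (rule \<nu>'.\<pi>_conditional) (auto simp flip: space_T)
    also have "A\<^sub>q q \<inter> space M = A\<^sub>q q"
      by (auto simp: sublevel_def)
    finally show "emeasure \<nu>' (A\<^sub>q q) = emeasure \<nu> (A\<^sub>q q)" ..
  qed
qed

text \<open>A tail event belongs to every \<open>F n\<close>, so \<open>gibbs_conditional\<close>
  applies to it for all \<open>n\<close>; dividing by its mass gives the Gibbs equations.\<close>

lemma uniform_measure_gibbs:
  assumes \<nu>: "\<nu> \<in> gibbs" and B: "B \<in> sets T" and pos: "emeasure \<nu> B \<noteq> 0"
  shows "uniform_measure \<nu> B \<in> gibbs"
proof -
  interpret tail_gibbs M F g \<phi> \<rho> \<nu>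
    using \<nu> by (rule tail_gibbsI)
  have [measurable]: "B \<in> sets M"
    using B subalg_T by (auto simp: subalgebra_def)
  have "(\<integral>\<^sup>+\<omega>. emeasure (g n \<omega>) A \<partial>uniform_measure \<nu> B) = emeasure (uniform_measure \<nu> B) A"
    if [measurable]: "A \<in> sets M" for n A
  proof -
    have "(\<integral>\<^sup>+\<omega>. emeasure (g n \<omega>) A \<partial>uniform_measure \<nu> B) = (\<integral>\<^sup>+\<omega>\<in>B. emeasure (g n \<omega>) A \<partial>\<nu>) / emeasure \<nu> B"
      by (rule nn_integral_uniform_measure) measurable
    also have "(\<integral>\<^sup>+\<omega>\<in>B. emeasure (g n \<omega>) A \<partial>\<nu>) = emeasure \<nu> (A \<inter> B)"
      using B by (intro gibbs_conditional) (auto simp: sets_T)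
    finally show ?thesis
      by (simp add: Int_commute)
  qed
  moreover have "prob_space (uniform_measure \<nu> B)"
    using pos by (intro prob_space_uniform_measure) auto
  ultimately show ?thesis
    by (simp add: gibbs_def space_prob_algebra)
qed

text \<open>A tail event of probability strictly between 0 and 1 would split \<nu> into its two
  conditional measures, both Gibbs and told apart by the event itself.\<close>

lemma extreme_tail_trivial:
  assumes \<nu>: "\<nu> \<in> extreme_measures gibbs" and B: "B \<in> sets T"
  shows "emeasure \<nu> B = 0 \<or> emeasure \<nu> B = 1"
proof (rule ccontr)
  assume not01: "\<not> ?thesis"
  have "\<nu> \<in> gibbs"
    using \<nu> by (simp add: extreme_measures_def)
  interpret tail_gibbs M F g \<phi> \<rho> \<nu>
    using \<open>\<nu> \<in> gibbs\<close> by (rule tail_gibbsI)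
  have B_M [measurable]: "B \<in> sets M"
    using B subalg_T by (auto simp: subalgebra_def)
  have B': "space M - B \<in> sets T"
    using sets.compl_sets[OF B] by (simp add: space_T)
  have compl: "prob (space M - B) = 1 - prob B"
    using prob_compl[of B] by (simp add: space_\<mu>)
  have t: "0 < prob B" "prob B < 1"
    using not01 prob_le_1[of B] by (auto simp: emeasure_eq_measure less_le)
  let ?\<nu>\<^sub>1 = "uniform_measure \<nu> B" and ?\<nu>\<^sub>2 = "uniform_measure \<nu> (space M - B)"
  have G: "?\<nu>\<^sub>1 \<in> gibbs" "?\<nu>\<^sub>2 \<in> gibbs"
    using t compl by (auto intro!: uniform_measure_gibbs B B' \<open>\<nu> \<in> gibbs\<close> simp: emeasure_eq_measure)
  have "measure \<nu> A = prob B * measure ?\<nu>\<^sub>1 A + (1 - prob B) * measure ?\<nu>\<^sub>2 A" if [measurable]: "A \<in> sets \<nu>" for A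
  proof -
    have "measure ?\<nu>\<^sub>1 A = prob (B \<inter> A) / prob B"
      using t that by (intro measure_uniform_measure) (auto simp: emeasure_eq_measure)
    moreover have "measure ?\<nu>\<^sub>2 A = prob ((space M - B) \<inter> A) / prob (space M - B)"
      using t compl that by (intro measure_uniform_measure) (auto simp: emeasure_eq_measure)
    moreover have "prob A = prob (B \<inter> A) + prob ((space M - B) \<inter> A)"
      using that sets.sets_into_space[of A M]
      by (subst finite_measure_Union[symmetric]) (auto intro!: arg_cong[where f = prob])
    ultimately show ?thesis
      using t compl by simp
  qed
  then have "?\<nu>\<^sub>1 = ?\<nu>\<^sub>2"
    using \<nu> G t unfolding extreme_measures_def by blast
  then have "emeasure ?\<nu>\<^sub>1 B = emeasure ?\<nu>\<^sub>2 B"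
    by simp
  moreover have "emeasure ?\<nu>\<^sub>1 B = 1"
    using t by (intro emeasure_uniform_measure_1) (auto simp: emeasure_eq_measure)
  moreover have "emeasure ?\<nu>\<^sub>2 B = 0"
    by (simp add: Diff_Int_distrib2)
  ultimately show False by simp
qed

text \<open>Events of probability 0 or 1 are independent of everything, so the constant \<nu>(A) is
  a conditional probability of \<open>A\<close> given the tail. By uniqueness \<pi>(A|.) equals it
  almost surely.\<close>

lemma extreme_trivial_gibbs:
  assumes \<nu>: "\<nu> \<in> extreme_measures gibbs"
  shows "\<nu> \<in> trivial_gibbs"
proof -
  have "\<nu> \<in> gibbs"
    using \<nu> by (simp add: extreme_measures_def)
  interpret tail_gibbs M F g \<phi> \<rho> \<nu>
    using \<open>\<nu> \<in> gibbs\<close> by (rule tail_gibbsI)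
  have "(\<integral>\<^sup>+\<sigma>. (emeasure (\<pi> \<sigma>) (A\<^sub>q q))\<^sup>2 \<partial>\<nu>) = (emeasure \<nu> (A\<^sub>q q))\<^sup>2" for q
  proof -
    have "AE \<sigma> in \<nu>. emeasure \<nu> (A\<^sub>q q) = nn_cond_exp \<nu> T (\<lambda>\<sigma>. emeasure (\<pi> \<sigma>) (A\<^sub>q q)) \<sigma>"
    proof (rule T.nn_cond_exp_charact)
      fix B assume B: "B \<in> sets T"
      then have B_M [measurable]: "B \<in> sets M"
        using subalg_T by (auto simp: subalgebra_def)
      have "emeasure \<nu> (A\<^sub>q q \<inter> B) = emeasure \<nu> (A\<^sub>q q) * emeasure \<nu> B"
        using extreme_tail_trivial[OF \<nu> B]
      proof
        assume 0: "emeasure \<nu> B = 0"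
        have "emeasure \<nu> (A\<^sub>q q \<inter> B) \<le> emeasure \<nu> B"
          by (rule emeasure_mono) auto
        then show ?thesis using 0 by simp
      next
        assume 1: "emeasure \<nu> B = 1"
        then have "AE \<sigma> in \<nu>. \<sigma> \<in> B"
          by (simp add: AE_in_set_eq_1 emeasure_eq_measure)
        then have "emeasure \<nu> (A\<^sub>q q \<inter> B) = emeasure \<nu> (A\<^sub>q q)"
          by (intro emeasure_eq_AE) (auto elim: eventually_mono)
        then show ?thesis using 1 by simp
      qed
      then show "(\<integral>\<^sup>+\<sigma>\<in>B. emeasure (\<pi> \<sigma>) (A\<^sub>q q) \<partial>\<nu>) = (\<integral>\<^sup>+\<sigma>\<in>B. emeasure \<nu> (A\<^sub>q q) \<partial>\<nu>)"
        using B by (simp add: \<pi>_conditional nn_integral_cmult_indicator)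
    qed auto
    moreover have "AE \<sigma> in \<nu>. emeasure (\<pi> \<sigma>) (A\<^sub>q q) = nn_cond_exp \<nu> T (\<lambda>\<sigma>. emeasure (\<pi> \<sigma>) (A\<^sub>q q)) \<sigma>"
      by (rule T.nn_cond_exp_F_meas[OF emeasure_\<pi>_T]) simp
    ultimately have "AE \<sigma> in \<nu>. emeasure (\<pi> \<sigma>) (A\<^sub>q q) = emeasure \<nu> (A\<^sub>q q)"
      by eventually_elim simp
    then have "(\<integral>\<^sup>+\<sigma>. (emeasure (\<pi> \<sigma>) (A\<^sub>q q))\<^sup>2 \<partial>\<nu>) = (\<integral>\<^sup>+\<sigma>. (emeasure \<nu> (A\<^sub>q q))\<^sup>2 \<partial>\<nu>)"
      by (intro nn_integral_cong_AE) auto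
    then show ?thesis
      by (simp add: emeasure_space_1)
  qed
  then show ?thesis
    using \<open>\<nu> \<in> gibbs\<close> by (simp add: trivial_gibbs_def)
qed

text \<open>A component of positive weight in a convex combination is absolutely continuous with
  respect to the whole, so \<open>trivial_gibbs_dominates\<close> identifies both components with
  \<nu>.\<close>

lemma trivial_gibbs_extreme:
  assumes \<nu>: "\<nu> \<in> trivial_gibbs"
  shows "\<nu> \<in> extreme_measures gibbs"
proof -
  have "\<nu> \<in> gibbs"
    using \<nu> by (simp add: trivial_gibbs_def)
  interpret tail_gibbs M F g \<phi> \<rho> \<nu>
    using \<open>\<nu> \<in> gibbs\<close> by (rule tail_gibbsI)
  have "\<nu>\<^sub>1 = \<nu>\<^sub>2"
    if G: "\<nu>\<^sub>1 \<in> gibbs" "\<nu>\<^sub>2 \<in> gibbs" and t: "0 < t" "t < 1"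
      and eq: "\<forall>A\<in>sets \<nu>. measure \<nu> A = t * measure \<nu>\<^sub>1 A + (1 - t) * measure \<nu>\<^sub>2 A" for \<nu>\<^sub>1 \<nu>\<^sub>2 and t :: real
  proof -
    have "measure \<nu>\<^sub>1 A = 0 \<and> measure \<nu>\<^sub>2 A = 0" if "A \<in> sets M" "measure \<nu> A = 0" for A
      using eq that t
      by (auto simp: add_nonneg_eq_0_iff dest!: bspec[of _ _ A])
    then have "\<nu>\<^sub>1 = \<nu>" "\<nu>\<^sub>2 = \<nu>"
      using trivial_gibbs_dominates[OF \<nu>] G by blast+
    then show ?thesis by simp
  qed
  then show ?thesis
    using \<open>\<nu> \<in> gibbs\<close> unfolding extreme_measures_def by blast
qed

lemma trivial_gibbs_eq_extreme: "trivial_gibbs = extreme_measures gibbs"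
  using trivial_gibbs_extreme extreme_trivial_gibbs by blast

lemma nn_integral_measurable_prob_algebra:
  "h \<in> borel_measurable M \<Longrightarrow> (\<lambda>\<nu>. \<integral>\<^sup>+\<omega>. h \<omega> \<partial>\<nu>) \<in> borel_measurable (prob_algebra M)"
  unfolding prob_algebra_def
  by (intro measurable_restrict_space1 nn_integral_measurable_subprob_algebra)

lemma sets_extreme_gibbs: "extreme_measures gibbs \<in> sets (prob_algebra M)"
proof -
  have [measurable]: "(\<lambda>\<nu>. emeasure \<nu> (A\<^sub>q q)) \<in> borel_measurable (prob_algebra M)" for q
    unfolding prob_algebra_def
    by (intro measurable_restrict_space1 measurable_emeasure_subprob_algebra) simp
  note [measurable] = nn_integral_measurable_prob_algebra
  \<comment> \<open>Only the Gibbs equations on the sets \<open>A\<^sub>q q\<close> are kept, which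
    leaves countably many conditions; \<open>gibbsI_A\<^sub>q\<close> recovers the others.\<close>
  have "trivial_gibbs = {\<nu> \<in> space (prob_algebra M).
      (\<forall>n q. (\<integral>\<^sup>+\<omega>. emeasure (g n \<omega>) (A\<^sub>q q) \<partial>\<nu>) = emeasure \<nu> (A\<^sub>q q)) \<and>
      (\<forall>q. (\<integral>\<^sup>+\<sigma>. (emeasure (\<pi> \<sigma>) (A\<^sub>q q))\<^sup>2 \<partial>\<nu>) = (emeasure \<nu> (A\<^sub>q q))\<^sup>2)}"
  proof (intro equalityI subsetI)
    fix \<nu> assume "\<nu> \<in> {\<nu> \<in> space (prob_algebra M).
      (\<forall>n q. (\<integral>\<^sup>+\<omega>. emeasure (g n \<omega>) (A\<^sub>q q) \<partial>\<nu>) = emeasure \<nu> (A\<^sub>q q)) \<and>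
      (\<forall>q. (\<integral>\<^sup>+\<sigma>. (emeasure (\<pi> \<sigma>) (A\<^sub>q q))\<^sup>2 \<partial>\<nu>) = (emeasure \<nu> (A\<^sub>q q))\<^sup>2)}"
    then show "\<nu> \<in> trivial_gibbs"
      unfolding trivial_gibbs_def by (blast intro: gibbsI_A\<^sub>q)
  qed (auto simp: trivial_gibbs_def gibbs_def)
  also have "\<dots> \<in> sets (prob_algebra M)"
    by measurable
  finally show ?thesis
    by (simp add: trivial_gibbs_eq_extreme)
qed

end

section \<open>Decomposition into extreme Gibbs measures\<close>

context tail_gibbs
begin

text \<open>The measure \<open>\<pi> \<omega>\<close> is tested against the kernel \<pi> itself: the
  square of \<pi>(A|.) is tail measurable, so its mean under \<open>\<pi> \<omega>\<close> is its
  value at \<omega>, which is the second moment condition.\<close>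

lemma AE_\<pi>_extreme: "AE \<omega> in \<mu>. \<pi> \<omega> \<in> extreme_measures gibbs"
proof -
  have "AE \<omega> in \<mu>. (\<integral>\<^sup>+\<sigma>. (emeasure (\<pi> \<sigma>) (A\<^sub>q q))\<^sup>2 \<partial>\<pi> \<omega>) = (emeasure (\<pi> \<omega>) (A\<^sub>q q))\<^sup>2" for q
    by (intro AE_nn_integral_\<pi>_tail borel_measurable_power_ennreal emeasure_\<pi>_T) simp
  then have "AE \<omega> in \<mu>. \<forall>q. (\<integral>\<^sup>+\<sigma>. (emeasure (\<pi> \<sigma>) (A\<^sub>q q))\<^sup>2 \<partial>\<pi> \<omega>) = (emeasure (\<pi> \<omega>) (A\<^sub>q q))\<^sup>2"
    by (simp add: AE_all_countable)
  with AE_\<pi>_gibbs show ?thesis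
    by eventually_elim (simp add: trivial_gibbs_def flip: trivial_gibbs_eq_extreme)
qed

end

context tail_gibbs
begin

text \<open>The form with functions is needed because \<open>h\<close> will be the kernel of a
  smaller set of sites.\<close>

lemma gibbs_nn_integral:
  assumes h: "h \<in> borel_measurable M"
  shows "(\<integral>\<^sup>+\<omega>. (\<integral>\<^sup>+\<sigma>. h \<sigma> \<partial>g n \<omega>) \<partial>\<mu>) = (\<integral>\<^sup>+\<omega>. h \<omega> \<partial>\<mu>)"
proof -
  have g_sub: "g n \<in> \<mu> \<rightarrow>\<^sub>M subprob_algebra M"
    using measurable_prob_algebraD[OF kernel_M] by measurable
  have "\<mu> \<bind> g n = \<mu>"
  proof (rule measure_eqI)
    show sets: "sets (\<mu> \<bind> g n) = sets \<mu>"
      using kernel_prob by (subst sets_bind[OF _ not_empty]) (auto simp: space_\<mu> space_prob_algebra)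
    fix A assume "A \<in> sets (\<mu> \<bind> g n)"
    then show "emeasure (\<mu> \<bind> g n) A = emeasure \<mu> A"
      unfolding sets by (simp add: emeasure_bind[OF not_empty g_sub] gibbs_kernel)
  qed
  then show ?thesis
    using nn_integral_bind[OF h g_sub] by simp
qed

lemma \<pi>_\<mu>: "\<pi> \<in> \<mu> \<rightarrow>\<^sub>M prob_algebra M"
  by measurable

lemma emeasure_kernel_weight_extreme:
  "emeasure (kernel_weight M \<pi> \<mu>) (extreme_measures gibbs) = 1"
proof -
  have "emeasure (kernel_weight M \<pi> \<mu>) (extreme_measures gibbs) =
      emeasure \<mu> (\<pi> -` extreme_measures gibbs \<inter> space \<mu>)"
    unfolding kernel_weight_def by (rule emeasure_distr[OF \<pi>_\<mu> sets_extreme_gibbs])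
  also have "\<dots> = 1"
    using AE_\<pi>_extreme AE_space
    by (intro emeasure_eq_1_AE measurable_sets[OF \<pi>_\<mu> sets_extreme_gibbs]) (auto elim: eventually_elim2)
  finally show ?thesis .
qed

lemma restrict_kernel_weight:
  "restrict_space (kernel_weight M \<pi> \<mu>) (extreme_measures gibbs)
    \<in> space (prob_algebra (restrict_space (prob_algebra M) (extreme_measures gibbs)))"
proof -
  have sets: "sets (kernel_weight M \<pi> \<mu>) = sets (prob_algebra M)"
    by (simp add: kernel_weight_def)
  have "prob_space (restrict_space (kernel_weight M \<pi> \<mu>) (extreme_measures gibbs))"
    using sets_extreme_gibbs emeasure_kernel_weight_extreme
    by (intro prob_space_restrict_space) (auto simp: sets)
  then show ?thesis
    by (simp add: space_prob_algebra sets_restrict_space_cong[OF sets])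
qed

lemma barycenter_kernel_weight:
  assumes A [measurable]: "A \<in> sets M"
  shows "emeasure \<mu> A = (\<integral>\<^sup>+\<nu>\<in>extreme_measures gibbs. emeasure \<nu> A \<partial>kernel_weight M \<pi> \<mu>)"
proof -
  have [measurable]: "(\<lambda>\<nu>. emeasure \<nu> A) \<in> borel_measurable (prob_algebra M)"
    unfolding prob_algebra_def
    by (intro measurable_restrict_space1 measurable_emeasure_subprob_algebra) simp
  have "(\<lambda>\<nu>. emeasure \<nu> A * indicator (extreme_measures gibbs) \<nu>) \<in> borel_measurable (prob_algebra M)"
    using sets_extreme_gibbs by measurable
  then have "(\<integral>\<^sup>+\<nu>\<in>extreme_measures gibbs. emeasure \<nu> A \<partial>kernel_weight M \<pi> \<mu>) =
      (\<integral>\<^sup>+\<omega>. emeasure (\<pi> \<omega>) A * indicator (extreme_measures gibbs) (\<pi> \<omega>) \<partial>\<mu>)"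
    by (simp add: kernel_weight_def nn_integral_distr[OF \<pi>_\<mu>])
  also have "\<dots> = (\<integral>\<^sup>+\<omega>\<in>space M. emeasure (\<pi> \<omega>) A \<partial>\<mu>)"
  proof (rule nn_integral_cong_AE)
    show "AE \<omega> in \<mu>. emeasure (\<pi> \<omega>) A * indicator (extreme_measures gibbs) (\<pi> \<omega>) =
        emeasure (\<pi> \<omega>) A * indicator (space M) \<omega>"
      using AE_\<pi>_extreme AE_space by eventually_elim (simp add: space_\<mu>)
  qed
  also have "\<dots> = emeasure \<mu> (A \<inter> space M)"
    by (rule \<pi>_conditional[OF A]) (auto simp flip: space_T)
  also have "A \<inter> space M = A"
    using sets.sets_into_space[OF A] by blast
  finally show ?thesis ..
qed

end

subsection \<open>Exhaustion by finite windows\<close>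

definition window :: "'i set \<Rightarrow> nat \<Rightarrow> 'i set" where
  "window S n = {i \<in> S. to_nat_on S i < n}"

lemma window_subset: "window S n \<subseteq> S"
  by (auto simp: window_def)

lemma window_mono: "m \<le> n \<Longrightarrow> window S m \<subseteq> window S n"
  by (auto simp: window_def)

lemma finite_window:
  assumes "countable S"
  shows "finite (window S n)"
proof (rule finite_imageD)
  show "finite (to_nat_on S ` window S n)"
    by (rule finite_subset[of _ "{..<n}"]) (auto simp: window_def)
  show "inj_on (to_nat_on S) (window S n)"
    using inj_on_to_nat_on[OF assms] window_subset by (rule inj_on_subset)
qed

lemma finite_subset_window:
  assumes "finite \<Lambda>" "\<Lambda> \<subseteq> S"
  obtains n where "\<Lambda> \<subseteq> window S n"
proof
  \<comment> \<open>\<open>Suc\<close> answers the strict inequality in \<open>window\<close>. For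
    empty \<Lambda> the maximum is an unspecified number and the inclusion is trivial.\<close>
  show "\<Lambda> \<subseteq> window S (Suc (Max (to_nat_on S ` \<Lambda>)))"
    using assms by (auto simp: window_def less_Suc_eq_le)
qed

lemma space_coord_algebra: "space (coord_algebra S E \<Delta>) = space (config_space S E)"
  unfolding coord_algebra_def by (rule space_measure_of) auto

lemma sets_coord_algebra:
  "sets (coord_algebra S E \<Delta>) = sigma_sets (space (config_space S E))
     {(\<lambda>\<omega>. \<omega> i) -` A \<inter> space (config_space S E) |i A. i \<in> \<Delta> \<and> A \<in> sets E}"
  unfolding coord_algebra_def by (rule sets_measure_of) auto

lemma sets_coord_algebra_mono: "\<Delta> \<subseteq> \<Delta>' \<Longrightarrow> sets (coord_algebra S E \<Delta>) \<subseteq> sets (coord_algebra S E \<Delta>')"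
  unfolding sets_coord_algebra by (rule sigma_sets_mono') blast

lemma subalgebra_coord_algebra:
  assumes "\<Delta> \<subseteq> S"
  shows "subalgebra (config_space S E) (coord_algebra S E \<Delta>)"
proof -
  have "(\<lambda>\<omega>. \<omega> i) -` A \<inter> space (config_space S E) \<in> sets (config_space S E)"
    if "i \<in> \<Delta>" "A \<in> sets E" for i A
    using assms that by (intro measurable_sets[OF measurable_component_singleton]) auto
  then have "sets (coord_algebra S E \<Delta>) \<subseteq> sets (config_space S E)"
    unfolding sets_coord_algebra by (intro sets.sigma_sets_subset) blast
  then show ?thesis
    by (simp add: subalgebra_def space_coord_algebra)
qed

lemma is_specificationD:
  assumes "is_specification S E \<gamma>" "finite \<Lambda>" "\<Lambda> \<subseteq> S"
  shows is_specification_kernel: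
      "\<gamma> \<Lambda> \<in> coord_algebra S E (S - \<Lambda>) \<rightarrow>\<^sub>M prob_algebra (config_space S E)"
    and is_specification_consistent:
      "\<Delta> \<subseteq> \<Lambda> \<Longrightarrow> A \<in> sets (config_space S E) \<Longrightarrow> \<omega> \<in> space (config_space S E) \<Longrightarrow>
        (\<integral>\<^sup>+\<sigma>. emeasure (\<gamma> \<Delta> \<sigma>) A \<partial>\<gamma> \<Lambda> \<omega>) = emeasure (\<gamma> \<Lambda> \<omega>) A"
    and is_specification_proper:
      "B \<in> sets (coord_algebra S E (S - \<Lambda>)) \<Longrightarrow> \<omega> \<in> space (config_space S E) \<Longrightarrow>
        emeasure (\<gamma> \<Lambda> \<omega>) B = indicator B \<omega>"
  using assms by (simp_all add: is_specification_def prob_kernel_iff_measurable)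

lemma tail_specification_window:
  assumes spec: "is_specification S E \<gamma>" and "countable S"
    and "\<phi> \<in> borel_measurable (config_space S E)" "\<rho> \<in> borel \<rightarrow>\<^sub>M config_space S E"
    and "\<And>\<omega>. \<omega> \<in> space (config_space S E) \<Longrightarrow> \<phi> \<omega> \<in> {0..1}"
    and "\<And>\<omega>. \<omega> \<in> space (config_space S E) \<Longrightarrow> \<rho> (\<phi> \<omega>) = \<omega>"
  shows "tail_specification (config_space S E) (\<lambda>n. coord_algebra S E (S - window S n))
    (\<lambda>n. \<gamma> (window S n)) \<phi> \<rho>"
proof
  fix n
  have W: "finite (window S n)" "window S n \<subseteq> S"
    by (simp_all add: finite_window[OF \<open>countable S\<close>] window_subset)
  show "subalgebra (config_space S E) (coord_algebra S E (S - window S n))"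
    by (rule subalgebra_coord_algebra) auto
  show "\<gamma> (window S n) \<in> coord_algebra S E (S - window S n) \<rightarrow>\<^sub>M prob_algebra (config_space S E)"
    by (rule is_specification_kernel[OF spec W])
  show "emeasure (\<gamma> (window S n) \<omega>) A = indicator A \<omega>"
    if "A \<in> sets (coord_algebra S E (S - window S n))" "\<omega> \<in> space (config_space S E)" for A \<omega>
    by (rule is_specification_proper[OF spec W that])
next
  fix m n :: nat assume "m \<le> n"
  then show "sets (coord_algebra S E (S - window S n)) \<subseteq> sets (coord_algebra S E (S - window S m))"
    using window_mono[of m n S] by (intro sets_coord_algebra_mono Diff_mono order_refl)
qed (use assms in auto)

text \<open>Consistency is used here: for \<Lambda> inside a window, averaging the kernel of
  \<Lambda> over the window kernel returns the window kernel, so invariance under windows passes to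
  every finite \<Lambda>.\<close>

lemma gibbs_measures_window:
  assumes spec: "is_specification S E \<gamma>" and "countable S"
    and "tail_specification (config_space S E) (\<lambda>n. coord_algebra S E (S - window S n))
      (\<lambda>n. \<gamma> (window S n)) \<phi> \<rho>"
  shows "gibbs_measures S E \<gamma> = tail_specification.gibbs (config_space S E) (\<lambda>n. \<gamma> (window S n))"
proof -
  let ?\<Omega> = "config_space S E"
  interpret tail_specification ?\<Omega> "\<lambda>n. coord_algebra S E (S - window S n)" "\<lambda>n. \<gamma> (window S n)" \<phi> \<rho>
    by fact
  have W: "finite (window S n)" "window S n \<subseteq> S" for n
    by (simp_all add: finite_window[OF \<open>countable S\<close>] window_subset)
  show ?thesis
  proof (intro equalityI subsetI)
    fix \<mu> assume "\<mu> \<in> gibbs_measures S E \<gamma>"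
    then show "\<mu> \<in> gibbs"
      using W unfolding gibbs_measures_def gibbs_def by blast
  next
    fix \<mu> assume \<mu>: "\<mu> \<in> gibbs"
    then interpret tail_gibbs ?\<Omega> "\<lambda>n. coord_algebra S E (S - window S n)" "\<lambda>n. \<gamma> (window S n)" \<phi> \<rho> \<mu>
      by (rule tail_gibbsI)
    have "(\<integral>\<^sup>+\<omega>. emeasure (\<gamma> \<Lambda> \<omega>) A \<partial>\<mu>) = emeasure \<mu> A"
      if \<Lambda>: "finite \<Lambda>" "\<Lambda> \<subseteq> S" and A: "A \<in> sets ?\<Omega>" for \<Lambda> A
    proof -
      obtain n where n: "\<Lambda> \<subseteq> window S n"
        using finite_subset_window[OF \<Lambda>] .
      have h: "(\<lambda>\<omega>. emeasure (\<gamma> \<Lambda> \<omega>) A) \<in> borel_measurable ?\<Omega>"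
        using measurable_prob_algebraD[OF measurable_from_subalg[OF
            subalgebra_coord_algebra[OF Diff_subset] is_specification_kernel[OF spec \<Lambda>]]]
          measurable_emeasure_subprob_algebra[OF A]
        by (rule measurable_compose)
      have "(\<integral>\<^sup>+\<omega>. emeasure (\<gamma> \<Lambda> \<omega>) A \<partial>\<mu>) =
          (\<integral>\<^sup>+\<omega>. (\<integral>\<^sup>+\<sigma>. emeasure (\<gamma> \<Lambda> \<sigma>) A \<partial>\<gamma> (window S n) \<omega>) \<partial>\<mu>)"
        by (rule gibbs_nn_integral[OF h, symmetric])
      also have "\<dots> = (\<integral>\<^sup>+\<omega>. emeasure (\<gamma> (window S n) \<omega>) A \<partial>\<mu>)"
      proof (rule nn_integral_cong)
        fix \<omega> assume "\<omega> \<in> space \<mu>"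
        then show "(\<integral>\<^sup>+\<sigma>. emeasure (\<gamma> \<Lambda> \<sigma>) A \<partial>\<gamma> (window S n) \<omega>) =
            emeasure (\<gamma> (window S n) \<omega>) A"
          by (intro is_specification_consistent[OF spec W n A]) (simp add: space_\<mu>)
      qed
      also have "\<dots> = emeasure \<mu> A"
        using A by (rule gibbs_kernel)
      finally show ?thesis .
    qed
    then show "\<mu> \<in> gibbs_measures S E \<gamma>"
      using \<mu> by (auto simp: gibbs_measures_def gibbs_def)
  qed
qed

theorem theorem2p1:
  fixes S :: "'i set" and E :: "'e measure" and P :: "'h measure"
    and \<gamma> :: "'h \<Rightarrow> 'i set \<Rightarrow> ('i \<Rightarrow> 'e) \<Rightarrow> ('i \<Rightarrow> 'e) measure"
    and \<mu> :: "'h \<Rightarrow> ('i \<Rightarrow> 'e) measure"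
  assumes "countable S"
    and "standard_borel E"
    and "prob_space P"
    and "random_specification S E P \<gamma>"
    and "AE \<xi> in P. gibbs_measures S E (\<gamma> \<xi>) \<noteq> {}"
    and "\<mu> \<in> P \<rightarrow>\<^sub>M prob_algebra (config_space S E)"
    and "AE \<xi> in P. \<mu> \<xi> \<in> gibbs_measures S E (\<gamma> \<xi>)"
  shows "\<exists>\<pi> :: 'h \<Rightarrow> ('i \<Rightarrow> 'e) \<Rightarrow> ('i \<Rightarrow> 'e) measure.
    prob_kernel (P \<Otimes>\<^sub>M config_space S E) (config_space S E) (\<lambda>(\<xi>, \<omega>). \<pi> \<xi> \<omega>) \<and>
    (\<lambda>\<xi>. kernel_weight (config_space S E) (\<pi> \<xi>) (\<mu> \<xi>))
      \<in> P \<rightarrow>\<^sub>M prob_algebra (prob_algebra (config_space S E)) \<and>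
    (AE \<xi> in P.
      let w = kernel_weight (config_space S E) (\<pi> \<xi>) (\<mu> \<xi>);
          exG = extreme_measures (gibbs_measures S E (\<gamma> \<xi>))
      in emeasure w exG = 1 \<and>
         restrict_space w exG
           \<in> space (prob_algebra (restrict_space (prob_algebra (config_space S E)) exG))) \<and>
    (AE \<xi> in P.
      let w = kernel_weight (config_space S E) (\<pi> \<xi>) (\<mu> \<xi>);
          exG = extreme_measures (gibbs_measures S E (\<gamma> \<xi>))
      in \<forall>A\<in>sets (config_space S E). emeasure (\<mu> \<xi>) A = (\<integral>\<^sup>+\<nu>\<in>exG. emeasure \<nu> A \<partial>w))"
proof -
  let ?\<Omega> = "config_space S E"
  \<comment> \<open>The value of \<mu> at any point of \<open>P\<close> is a probability measure,
    which shows that configurations exist.\<close>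
  obtain \<xi>\<^sub>0 where "\<xi>\<^sub>0 \<in> space P"
    using prob_space.not_empty[OF \<open>prob_space P\<close>] by blast
  then have \<mu>\<^sub>0: "sets (\<mu> \<xi>\<^sub>0) = sets ?\<Omega>" "prob_space (\<mu> \<xi>\<^sub>0)"
    using measurable_space[OF assms(6)] by (auto simp: space_prob_algebra)
  then have "space ?\<Omega> \<noteq> {}"
    using prob_space.not_empty sets_eq_imp_space_eq by metis
  then have "measurable_retract ?\<Omega> (restrict_space borel {0..1::real})"
    by (rule config_space_measurable_retract[OF assms(1,2)])
  then obtain \<phi> :: "('i \<Rightarrow> 'e) \<Rightarrow> real" and \<rho> where
    \<phi>\<rho>: "\<phi> \<in> borel_measurable ?\<Omega>" "\<rho> \<in> borel \<rightarrow>\<^sub>M ?\<Omega>"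
      "\<And>\<omega>. \<omega> \<in> space ?\<Omega> \<Longrightarrow> \<phi> \<omega> \<in> {0..1}" "\<And>\<omega>. \<omega> \<in> space ?\<Omega> \<Longrightarrow> \<rho> (\<phi> \<omega>) = \<omega>"
    by (rule measurable_retract_restrictE) (blast intro: that)
  \<comment> \<open>The specification enters this formula but \<mu> does not, so joint measurability
    comes from that of the specification.\<close>
  define \<pi> where "\<pi> \<xi> \<omega> = limit_measure ?\<Omega> \<phi> \<rho> (\<lambda>n. \<gamma> \<xi> (window S n) \<omega>)" for \<xi> \<omega>
  have spec: "is_specification S E (\<gamma> \<xi>)" if "\<xi> \<in> space P" for \<xi>
    using assms(4) that by (simp add: random_specification_def)
  note tail_spec = tail_specification_window[OF spec \<open>countable S\<close> \<phi>\<rho>]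
  have \<pi>_meas: "(\<lambda>(\<xi>, \<omega>). \<pi> \<xi> \<omega>) \<in> P \<Otimes>\<^sub>M ?\<Omega> \<rightarrow>\<^sub>M prob_algebra ?\<Omega>"
  proof -
    have "(\<lambda>p. \<gamma> (fst p) (window S n) (snd p)) \<in> P \<Otimes>\<^sub>M ?\<Omega> \<rightarrow>\<^sub>M prob_algebra ?\<Omega>" for n
    proof -
      have "\<gamma> \<xi> (window S n) \<omega> \<in> space (prob_algebra ?\<Omega>)" if "\<xi> \<in> space P" "\<omega> \<in> space ?\<Omega>" for \<xi> \<omega>
        using tail_specification.kernel_prob[OF tail_spec] that by blast
      moreover have "(\<lambda>(\<xi>, \<omega>). emeasure (\<gamma> \<xi> (window S n) \<omega>) A) \<in> borel_measurable (P \<Otimes>\<^sub>M ?\<Omega>)"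
        if "A \<in> sets ?\<Omega>" for A
        using assms(4) finite_window[OF \<open>countable S\<close>, of n] window_subset[of S n] that
        unfolding random_specification_def by blast
      ultimately have "prob_kernel (P \<Otimes>\<^sub>M ?\<Omega>) ?\<Omega> (\<lambda>p. \<gamma> (fst p) (window S n) (snd p))"
        unfolding prob_kernel_def by (auto simp: space_pair_measure split_beta)
      then show ?thesis
        by (simp add: prob_kernel_iff_measurable)
    qed
    then have "(\<lambda>p. \<pi> (fst p) (snd p)) \<in> P \<Otimes>\<^sub>M ?\<Omega> \<rightarrow>\<^sub>M prob_algebra ?\<Omega>"
      unfolding \<pi>_def using \<phi>\<rho> by (intro measurable_limit_measure)
    then show ?thesis
      by (simp add: split_beta)
  qed
  \<comment> \<open>With \<xi> fixed the argument is deterministic; the exceptional null set of the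
    conclusions is the one where \<open>\<mu> \<xi>\<close> fails to be Gibbs.\<close>
  have main: "emeasure (kernel_weight ?\<Omega> (\<pi> \<xi>) (\<mu> \<xi>)) (extreme_measures (gibbs_measures S E (\<gamma> \<xi>))) = 1 \<and>
      restrict_space (kernel_weight ?\<Omega> (\<pi> \<xi>) (\<mu> \<xi>)) (extreme_measures (gibbs_measures S E (\<gamma> \<xi>)))
        \<in> space (prob_algebra (restrict_space (prob_algebra ?\<Omega>) (extreme_measures (gibbs_measures S E (\<gamma> \<xi>))))) \<and>
      (\<forall>A\<in>sets ?\<Omega>. emeasure (\<mu> \<xi>) A =
        (\<integral>\<^sup>+\<nu>\<in>extreme_measures (gibbs_measures S E (\<gamma> \<xi>)). emeasure \<nu> A \<partial>kernel_weight ?\<Omega> (\<pi> \<xi>) (\<mu> \<xi>)))"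
    if \<xi>: "\<xi> \<in> space P" and \<mu>: "\<mu> \<xi> \<in> gibbs_measures S E (\<gamma> \<xi>)" for \<xi>
  proof -
    interpret spec: tail_specification ?\<Omega> "\<lambda>n. coord_algebra S E (S - window S n)"
      "\<lambda>n. \<gamma> \<xi> (window S n)" \<phi> \<rho>
      using \<xi> by (rule tail_spec)
    have G: "gibbs_measures S E (\<gamma> \<xi>) = spec.gibbs"
      using \<xi> by (intro gibbs_measures_window[OF spec \<open>countable S\<close> tail_spec])
    interpret tail_gibbs ?\<Omega> "\<lambda>n. coord_algebra S E (S - window S n)"
      "\<lambda>n. \<gamma> \<xi> (window S n)" \<phi> \<rho> "\<mu> \<xi>"
      using \<mu> unfolding G by (rule spec.tail_gibbsI)
    have \<pi>_\<xi>: "\<pi> \<xi> = spec.\<pi>"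
      by (simp add: fun_eq_iff \<pi>_def spec.\<pi>_def)
    show ?thesis
      unfolding G \<pi>_\<xi>
      using emeasure_kernel_weight_extreme restrict_kernel_weight barycenter_kernel_weight by blast
  qed
  show ?thesis
  proof (intro exI[of _ \<pi>] conjI)
    show "prob_kernel (P \<Otimes>\<^sub>M ?\<Omega>) ?\<Omega> (\<lambda>(\<xi>, \<omega>). \<pi> \<xi> \<omega>)"
      using \<pi>_meas by (simp add: prob_kernel_iff_measurable)
    show "(\<lambda>\<xi>. kernel_weight ?\<Omega> (\<pi> \<xi>) (\<mu> \<xi>)) \<in> P \<rightarrow>\<^sub>M prob_algebra (prob_algebra ?\<Omega>)"
      unfolding kernel_weight_def by (rule measurable_distr_prob_space2[OF assms(6) \<pi>_meas])
  qed (use assms(7) AE_space in \<open>eventually_elim, use main in \<open>simp add: Let_def\<close>\<close>)+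
qed

end
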